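(* Let $T>0$, let $H(p)=\frac{\langle Ap,p\rangle}{2}$ for some positive definite matrix $A\in\mathcal{M}_N(\mathbb{R})$, and let $u_T\in\mathrm{Lip}(\mathbb{R}^N)$ be compactly supported. Then the optimization problem $$\underset{\varphi\in\mathcal{R}_T}{\text{minimize}}\ \mathcal{H}(\varphi):=\|\varphi-u_T\|_{L^2(\mathbb{R}^N)}$$ has a unique solution $\varphi^*\in\mathrm{Lip}(\mathbb{R}^N)\cap L^2(\mathbb{R}^N)$, where $\mathcal{R}_T$ is the reachable set at time $T$ (defined in the context).
   Context: $\mathrm{Lip}(\mathbb{R}^N)$ is the space of (globally) Lipschitz functions $\mathbb{R}^N\to\mathbb{R}$. The reachable set $\mathcal{R}_T$ is the set of functions $\psi\in\mathrm{Lip}(\mathbb{R}^N)$ for which there exists $u_0\in\mathrm{Lip}(\mathbb{R}^N)$ such that the viscosity solution $u$ of $\partial_tu+H(\nabla_xu)=0$ in $(0,T)\times\mathbb{R}^N$, $u(0,\cdot)=u_0$, satisfies $u(T,\cdot)=\psi$. *)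

theory Defs
  imports "HOL-Analysis.Analysis"
begin

definition Lip :: "((real ^ 'n) \<Rightarrow> real) set" where
  "Lip = {f. \<exists>L. L-lipschitz_on UNIV f}"

(* The two halves of the definition of a viscosity solution of u_t + H(grad_x u) = 0 on the
   open set W of pairs (t, x).  For a test function v, the gradient g (t, x) in the product space
   is the pair (v_t, grad_x v), so fst and snd pick out the time derivative and the spatial
   gradient.  The condition on u - v says that it has a local extremum at z. *)

definition C1_with_gradient ::
  "(real \<times> (real ^ 'n)) set \<Rightarrow> (real \<times> (real ^ 'n) \<Rightarrow> real)
    \<Rightarrow> (real \<times> (real ^ 'n) \<Rightarrow> real \<times> (real ^ 'n)) \<Rightarrow> bool" where
  "C1_with_gradient W v g \<longleftrightarrow> continuous_on W g \<and> (\<forall>z\<in>W. GDERIV v z :> g z)"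

definition viscosity_subsolution_on ::
  "(real \<times> (real ^ 'n)) set \<Rightarrow> ((real ^ 'n) \<Rightarrow> real) \<Rightarrow> (real \<times> (real ^ 'n) \<Rightarrow> real) \<Rightarrow> bool" where
  "viscosity_subsolution_on W H u \<longleftrightarrow>
    (\<forall>v g. C1_with_gradient W v g \<longrightarrow>
      (\<forall>z\<in>W. (\<forall>\<^sub>F w in nhds z. u w - v w \<le> u z - v z) \<longrightarrow>
        fst (g z) + H (snd (g z)) \<le> 0))"

definition viscosity_supersolution_on ::
  "(real \<times> (real ^ 'n)) set \<Rightarrow> ((real ^ 'n) \<Rightarrow> real) \<Rightarrow> (real \<times> (real ^ 'n) \<Rightarrow> real) \<Rightarrow> bool" where
  "viscosity_supersolution_on W H u \<longleftrightarrow>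
    (\<forall>v g. C1_with_gradient W v g \<longrightarrow>
      (\<forall>z\<in>W. (\<forall>\<^sub>F w in nhds z. u w - v w \<ge> u z - v z) \<longrightarrow>
        fst (g z) + H (snd (g z)) \<ge> 0))"

(* Uniform continuity up to the initial and terminal times is the usual class in which the
   viscosity solution with Lipschitz initial datum exists and is unique. *)

definition viscosity_solution ::
  "((real ^ 'n) \<Rightarrow> real) \<Rightarrow> real \<Rightarrow> ((real ^ 'n) \<Rightarrow> real) \<Rightarrow> (real \<times> (real ^ 'n) \<Rightarrow> real) \<Rightarrow> bool" where
  "viscosity_solution H T u0 u \<longleftrightarrow>
    uniformly_continuous_on ({0..T} \<times> UNIV) u \<and>
    (\<forall>x. u (0, x) = u0 x) \<and>
    viscosity_subsolution_on ({0<..<T} \<times> UNIV) H u \<and>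
    viscosity_supersolution_on ({0<..<T} \<times> UNIV) H u"

definition reachable_set ::
  "((real ^ 'n) \<Rightarrow> real) \<Rightarrow> real \<Rightarrow> ((real ^ 'n) \<Rightarrow> real) set" where
  "reachable_set H T =
    {\<psi> \<in> Lip. \<exists>u0\<in>Lip. \<exists>u. viscosity_solution H T u0 u \<and> (\<forall>x. u (T, x) = \<psi> x)}"

(* Symmetry is not required: the quadratic form only sees the symmetric part of the matrix. *)

definition positive_definite_matrix :: "real ^ 'n ^ 'n \<Rightarrow> bool" where
  "positive_definite_matrix A \<longleftrightarrow> (\<forall>p. p \<noteq> 0 \<longrightarrow> (A *v p) \<bullet> p > 0)"

definition L2 :: "((real ^ 'n) \<Rightarrow> real) set" where
  "L2 = {f. f \<in> borel_measurable lborel \<and> integrable lborel (\<lambda>x. (f x)\<^sup>2)}"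

(* Extended-valued, so that functions outside L2 have infinite norm. *)

definition L2_norm :: "((real ^ 'n) \<Rightarrow> real) \<Rightarrow> ennreal" where
  "L2_norm f =
    (let I = (\<integral>\<^sup>+ x. ennreal ((f x)\<^sup>2) \<partial>lborel)
     in if I = \<infinity> then \<infinity> else ennreal (sqrt (enn2real I)))"

end

theory Submission
  imports Defs
begin

text \<open>With \<open>S\<close> the symmetric part of \<open>A\<close>, \<open>B = S\<^sup>-\<^sup>1\<close> and \<open>L q = \<langle>B q, q\<rangle> / 2\<close>, the viscosity solution
  is given by the Hopf--Lax formula \<open>u (t, x) = min\<^sub>q u\<^sub>0 (x - t q) + t L q\<close> (comparison principle).
  Hence \<open>\<psi>\<close> is reachable iff it is Lipschitz and semiconcave in the sense that it has a supergradient
  at every point up to the error \<open>L (y - x) / T\<close>; the initial datum is then obtained by solving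
  backwards.  This condition is convex, so the parallelogram identity makes minimizing sequences
  Cauchy in \<open>L\<^sup>2\<close> and gives uniqueness.  The reachable set is not closed in \<open>L\<^sup>2\<close> for lack of a
  uniform Lipschitz bound, but a semiconcave function is bounded and Lipschitz with constants
  controlled by its \<open>L\<^sup>2\<close> norm, so that a minimizing sequence converges pointwise to an element of
  the set, and Fatou's lemma applies.\<close>

subsection \<open>Comparison principle\<close>

text \<open>A segment inside the convex set is cut into pieces shorter than the \<open>d\<close>
  belonging to \<open>\<gamma>\<close>; each piece costs at most \<open>\<gamma>\<close>, and their
  number grows linearly with the distance. This gives uniformly continuous solutions at most linear
  growth of their differences, with an arbitrarily small offset.\<close>

lemma uniformly_continuous_on_convex_affine_modulus:
  fixes u :: "'a::real_normed_vector \<Rightarrow> real"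
  assumes uc: "uniformly_continuous_on S u" and S: "convex S" and \<gamma>: "\<gamma> > 0"
  obtains C where "C \<ge> 0" "\<And>x y. x \<in> S \<Longrightarrow> y \<in> S \<Longrightarrow> \<bar>u x - u y\<bar> \<le> \<gamma> + C * dist x y"
proof -
  obtain d where d: "d > 0" and du: "\<And>x y. x \<in> S \<Longrightarrow> y \<in> S \<Longrightarrow> dist x y < d \<Longrightarrow> \<bar>u x - u y\<bar> < \<gamma>"
    using uc \<gamma> unfolding uniformly_continuous_on_def dist_real_def by metis
  have chain: "\<bar>u x - u y\<bar> \<le> real (Suc n) * \<gamma>"
    if "x \<in> S" "y \<in> S" "dist x y < real (Suc n) * d" for n x y
    using that
  proof (induction n arbitrary: x)
    case 0
    then show ?case using du[of x y] by simp
  next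
    case (Suc n)
    \<comment> \<open>The first piece is the fraction \<open>1 / (n + 2)\<close> of the segment,
      hence shorter than \<open>d\<close>; what remains satisfies the bound of the induction
      hypothesis.\<close>
    define k where "k = 1 / real (Suc (Suc n))"
    have k: "0 < k" "k \<le> 1" and k1: "(1 - k) * real (Suc (Suc n)) = real (Suc n)"
      by (auto simp: k_def field_simps)
    define z where "z = (1 - k) *\<^sub>R x + k *\<^sub>R y"
    have z: "z \<in> S" using S Suc.prems(1,2) k unfolding z_def by (auto intro: convexD)
    have "x - z = k *\<^sub>R (x - y)" "z - y = (1 - k) *\<^sub>R (x - y)"
      by (auto simp: z_def algebra_simps)
    then have dz: "dist x z = k * dist x y" "dist z y = (1 - k) * dist x y"
      using k by (auto simp: dist_norm)
    have "dist x z < d" using Suc.prems(3) unfolding dz k_def by (simp add: field_simps)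
    then have "\<bar>u x - u z\<bar> < \<gamma>" using du Suc.prems(1) z by blast
    moreover have "dist z y < real (Suc n) * d"
    proof (cases "1 - k = 0")
      case True
      then show ?thesis using d by (simp add: dz)
    next
      case False
      then have "(1 - k) * dist x y < (1 - k) * (real (Suc (Suc n)) * d)"
        using k Suc.prems(3) by (intro mult_strict_left_mono) auto
      then show ?thesis unfolding dz mult.assoc[symmetric] k1 .
    qed
    then have "\<bar>u z - u y\<bar> \<le> real (Suc n) * \<gamma>" using Suc.IH z Suc.prems(2) by blast
    ultimately show ?case by (simp add: algebra_simps)
  qed
  show ?thesis
  proof
    show "\<gamma> / d \<ge> 0" using d \<gamma> by simp
    fix x y assume xy: "x \<in> S" "y \<in> S"
    define n where "n = nat \<lfloor>dist x y / d\<rfloor>"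
    have n: "real n \<le> dist x y / d" "dist x y / d < real (Suc n)"
      using d by (auto simp: n_def) linarith
    have "\<bar>u x - u y\<bar> \<le> real (Suc n) * \<gamma>"
      using n(2) d xy by (intro chain) (auto simp: field_simps)
    also have "\<dots> \<le> \<gamma> + \<gamma> / d * dist x y"
      using mult_right_mono[OF n(1), of \<gamma>] \<gamma> by (simp add: algebra_simps)
    finally show "\<bar>u x - u y\<bar> \<le> \<gamma> + \<gamma> / d * dist x y" .
  qed
qed

text \<open>One family of test functions serves both sides: the subsolution takes positive
  parameters, the supersolution \<open>- \<epsilon>\<close>, \<open>- \<eta>\<close> and
  \<open>\<delta> = 0\<close>.\<close>

lemma C1_with_gradient_penalty:
  fixes y :: "real ^ 'n"
  assumes "\<epsilon> \<noteq> 0"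
  shows "C1_with_gradient ({0<..<T} \<times> UNIV)
    (\<lambda>(t, x). ((t - s)\<^sup>2 + (x - y) \<bullet> (x - y)) / (2 * \<epsilon>) + \<eta> / (T - t) + \<delta> * (x \<bullet> x))
    (\<lambda>(t, x). ((t - s) / \<epsilon> + \<eta> / (T - t)\<^sup>2, (1 / \<epsilon>) *\<^sub>R (x - y) + (2 * \<delta>) *\<^sub>R x))"
  unfolding C1_with_gradient_def
proof (intro conjI ballI)
  show "continuous_on ({0<..<T} \<times> UNIV) (\<lambda>(t, x). ((t - s) / \<epsilon> + \<eta> / (T - t)\<^sup>2,
      (1 / \<epsilon>) *\<^sub>R (x - y) + (2 * \<delta>) *\<^sub>R x))"
    unfolding case_prod_unfold using assms by (intro continuous_intros) auto
  fix z :: "real \<times> (real ^ 'n)" assume "z \<in> {0<..<T} \<times> UNIV"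
  then obtain t x where z: "z = (t, x)" "0 < t" "t < T" by auto
  show "GDERIV (\<lambda>(t, x). ((t - s)\<^sup>2 + (x - y) \<bullet> (x - y)) / (2 * \<epsilon>) + \<eta> / (T - t) + \<delta> * (x \<bullet> x)) z
      :> (case z of (t, x) \<Rightarrow> ((t - s) / \<epsilon> + \<eta> / (T - t)\<^sup>2, (1 / \<epsilon>) *\<^sub>R (x - y) + (2 * \<delta>) *\<^sub>R x))"
    unfolding gderiv_def case_prod_unfold
    using z assms
    by (auto intro!: derivative_eq_intros simp: inner_prod_def fun_eq_iff)
      (auto simp: inner_commute inner_simps field_simps power2_eq_square)
qed

text \<open>Doubling of variables: at a maximum of
  \<open>U z - V w - \<bar>z - w\<bar>\<^sup>2 / (2 \<epsilon>) - penalties\<close> the two test functions have the same gradient up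
  to the penalties.  As \<open>\<epsilon>\<close> stays fixed while \<open>\<delta>\<close> is chosen small, this gradient remains in a
  fixed ball, and mere continuity of \<open>H\<close> suffices.\<close>

theorem viscosity_comparison:
  fixes U V :: "real \<times> (real ^ 'n) \<Rightarrow> real"
  assumes H: "continuous_on UNIV H"
    and ucU: "uniformly_continuous_on ({0..T} \<times> UNIV) U"
    and ucV: "uniformly_continuous_on ({0..T} \<times> UNIV) V"
    and sub: "viscosity_subsolution_on ({0<..<T} \<times> UNIV) H U"
    and super: "viscosity_supersolution_on ({0<..<T} \<times> UNIV) H V"
    and init: "\<And>x. U (0, x) \<le> V (0, x)"
    and t0: "0 \<le> t0" "t0 < T"
  shows "U (t0, x0) \<le> V (t0, x0)"
proof (rule ccontr)
  define \<theta> where "\<theta> = U (t0, x0) - V (t0, x0)"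
  assume "\<not> U (t0, x0) \<le> V (t0, x0)"
  then have \<theta>: "\<theta> > 0" by (simp add: \<theta>_def)
  have T: "T > 0" using t0 by simp
  have conv: "convex ({0..T} \<times> (UNIV :: (real ^ 'n) set))"
    by (intro convex_Times convex_UNIV) auto
  obtain CU where CU: "CU \<ge> 0" and U: "\<And>z w. z \<in> {0..T} \<times> UNIV \<Longrightarrow> w \<in> {0..T} \<times> UNIV \<Longrightarrow>
      \<bar>U z - U w\<bar> \<le> \<theta> / 8 + CU * dist z w"
    using uniformly_continuous_on_convex_affine_modulus[OF ucU conv, of "\<theta> / 8"] \<theta> by auto
  obtain CV where CV: "CV \<ge> 0" and V: "\<And>z w. z \<in> {0..T} \<times> UNIV \<Longrightarrow> w \<in> {0..T} \<times> UNIV \<Longrightarrow>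
      \<bar>V z - V w\<bar> \<le> \<theta> / 8 + CV * dist z w"
    using uniformly_continuous_on_convex_affine_modulus[OF ucV conv, of "\<theta> / 8"] \<theta> by auto
  define C where "C = max CU CV"
  have C: "C \<ge> 0" "CU \<le> C" "CV \<le> C" using CU by (auto simp: C_def)
  have U: "\<bar>U z - U w\<bar> \<le> \<theta> / 8 + C * dist z w"
    if "z \<in> {0..T} \<times> UNIV" "w \<in> {0..T} \<times> UNIV" for z w
    using U[OF that] mult_right_mono[OF C(2), of "dist z w"] by auto
  have V: "\<bar>V z - V w\<bar> \<le> \<theta> / 8 + C * dist z w"
    if "z \<in> {0..T} \<times> UNIV" "w \<in> {0..T} \<times> UNIV" for z w
    using V[OF that] mult_right_mono[OF C(3), of "dist z w"] by auto
  define q where "q z w = (fst z - fst w)\<^sup>2 + (snd z - snd w) \<bullet> (snd z - snd w)"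
    for z w :: "real \<times> (real ^ 'n)"
  have q: "q z w = (dist z w)\<^sup>2" for z w
    by (simp add: q_def dist_prod_def dist_real_def real_sqrt_pow2 power2_norm_eq_inner dist_norm)
  \<comment> \<open>Small enough that, by \<open>young\<close>, a maximum at time 0 would have value
    at most \<open>\<theta> / 8 + C\<^sup>2 * \<epsilon> / 2\<close>, which is below
    \<open>\<theta> / 2\<close>.\<close>
  define \<epsilon> where "\<epsilon> = \<theta> / (4 * (C\<^sup>2 + 1))"
  have \<epsilon>: "\<epsilon> > 0" using \<theta> by (auto simp: \<epsilon>_def intro!: divide_pos_pos add_nonneg_pos)
  have C2\<epsilon>: "C\<^sup>2 * \<epsilon> \<le> \<theta> / 4"
  proof -
    have "C\<^sup>2 * \<epsilon> \<le> (C\<^sup>2 + 1) * \<epsilon>" using \<epsilon> by (simp add: algebra_simps)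
    also have "\<dots> = \<theta> / 4"
    proof -
      have "a * (\<theta> / (4 * a)) = \<theta> / 4" if "a \<noteq> 0" for a using that by simp
      moreover have "C\<^sup>2 + 1 \<noteq> 0" using zero_le_power2[of C] by linarith
      ultimately show ?thesis unfolding \<epsilon>_def by blast
    qed
    finally show ?thesis .
  qed
  \<comment> \<open>\<open>young\<close> spends the whole quadratic penalty to absorb the linear
    growth; \<open>young'\<close> spends half of it, so that the other half bounds the distance of
    the two points.\<close>
  have young: "C * d \<le> d\<^sup>2 / (2 * \<epsilon>) + C\<^sup>2 * \<epsilon> / 2"
    and young': "C * d \<le> d\<^sup>2 / (4 * \<epsilon>) + C\<^sup>2 * \<epsilon>" for d
  proof -
    have "0 \<le> (d - C * \<epsilon>)\<^sup>2 / (2 * \<epsilon>)" "0 \<le> (d - 2 * C * \<epsilon>)\<^sup>2 / (4 * \<epsilon>)" using \<epsilon> by auto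
    then show "C * d \<le> d\<^sup>2 / (2 * \<epsilon>) + C\<^sup>2 * \<epsilon> / 2" "C * d \<le> d\<^sup>2 / (4 * \<epsilon>) + C\<^sup>2 * \<epsilon>"
      using \<epsilon> by (simp_all add: field_simps power2_eq_square)
  qed
  \<comment> \<open>Moving both points to time 0 costs \<open>C * T\<close> each, and the three
    offsets \<open>\<theta> / 8\<close> fit into \<open>\<theta> / 2\<close>.\<close>
  define M where "M = \<theta> / 2 + 2 * C * T"
  have M: "M > 0" using \<theta> C T by (auto simp: M_def intro!: add_pos_nonneg)
  have initial: "U z - V w \<le> \<theta> / 8 + C * dist z w"
    if "z \<in> {0..T} \<times> UNIV" "w \<in> {0..T} \<times> UNIV" "fst z = 0 \<or> fst w = 0" for z w
  proof -
    from that(3) have "U w \<le> V w \<or> U z \<le> V z" by (metis init prod.collapse)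
    then show ?thesis using U[OF that(1,2)] V[OF that(1,2)] by linarith
  qed
  have global: "U z - V w \<le> M + C * dist z w"
    if zw: "z \<in> {0..T} \<times> UNIV" "w \<in> {0..T} \<times> UNIV" for z w
  proof -
    have "(0, snd z) \<in> {0..T} \<times> UNIV" "(0, snd w) \<in> {0..T} \<times> UNIV" using T by auto
    moreover have "dist z (0, snd z) \<le> T" "dist w (0, snd w) \<le> T"
      using zw by (auto simp: dist_prod_def)
    then have "C * dist z (0, snd z) \<le> C * T" "C * dist w (0, snd w) \<le> C * T"
      using C by (auto intro: mult_left_mono)
    moreover have "C * dist (0::real, snd z) (0, snd w) \<le> C * dist z w"
      using C dist_snd_le[of z w] by (intro mult_left_mono) (auto simp: dist_prod_def)
    ultimately show ?thesis
      using U[of z "(0, snd z)"] V[of w "(0, snd w)"] U[of "(0, snd z)" "(0, snd w)"]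
        init[of "snd w"] zw \<theta> unfolding M_def by linarith
  qed
  define M1 where "M1 = M + C\<^sup>2 * \<epsilon> / 2"
  have M1: "M1 > 0" using M \<epsilon> by (auto simp: M1_def intro!: add_pos_nonneg)
  \<comment> \<open>\<open>D\<close> depends on neither \<open>\<delta>\<close> nor
    \<open>\<eta>\<close>: it bounds the distance wherever the doubled function is nonnegative, so
    \<open>D / \<epsilon>\<close> bounds the common gradient before \<open>\<delta>\<close> is
    chosen.\<close>
  define D where "D = sqrt (4 * \<epsilon> * (M + C\<^sup>2 * \<epsilon>))"
  \<comment> \<open>The barrier \<open>\<eta> / (T - t)\<close> keeps maxima away from time
    \<open>T\<close> and makes the final inequality strict; at \<open>t0\<close> its two copies cost
    only \<open>\<theta> / 4\<close> together.\<close>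
  define \<eta> where "\<eta> = \<theta> * (T - t0) / 8"
  have \<eta>: "\<eta> > 0" using \<theta> t0 by (simp add: \<eta>_def)
  have "uniformly_continuous_on (cball 0 (D / \<epsilon> + 1)) H"
    by (intro compact_uniformly_continuous continuous_on_subset[OF H]) auto
  moreover have "\<eta> / T\<^sup>2 > 0" using \<eta> T by simp
  ultimately obtain \<rho> where \<rho>: "\<rho> > 0"
    and \<rho>': "\<forall>p\<in>cball 0 (D / \<epsilon> + 1). \<forall>p'\<in>cball 0 (D / \<epsilon> + 1). dist p' p < \<rho> \<longrightarrow> dist (H p') (H p) < \<eta> / T\<^sup>2"
    unfolding uniformly_continuous_on_def by blast
  have H\<rho>: "\<bar>H p' - H p\<bar> < \<eta> / T\<^sup>2"
    if "norm p \<le> D / \<epsilon> + 1" "norm p' \<le> D / \<epsilon> + 1" "dist p' p < \<rho>" for p p'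
    using \<rho>' that by (auto simp: dist_real_def)
  define m where "m = min \<rho> 1"
  have m: "m > 0" "m \<le> \<rho>" "m \<le> 1" using \<rho> by (auto simp: m_def)
  \<comment> \<open>The first bound keeps the penalty at \<open>x0\<close> below
    \<open>\<theta> / 4\<close>. The second, together with
    \<open>\<delta> * (x \<bullet> x) \<le> M1\<close>, makes the gradient perturbation
    \<open>2 * \<delta> * x\<close> shorter than \<open>m\<close>.\<close>
  define \<delta> where "\<delta> = min (\<theta> / (4 * (x0 \<bullet> x0 + 1))) (m\<^sup>2 / (8 * M1))"
  have x0: "x0 \<bullet> x0 + 1 > 0" by (simp add: add_nonneg_pos)
  have \<delta>: "\<delta> > 0" using \<theta> m M1 x0 by (simp add: \<delta>_def)
  have \<delta>0: "\<delta> * (x0 \<bullet> x0) \<le> \<theta> / 4"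
  proof -
    have "\<delta> * (x0 \<bullet> x0) \<le> \<delta> * (x0 \<bullet> x0 + 1)" using \<delta> by simp
    also have "\<dots> \<le> \<theta> / (4 * (x0 \<bullet> x0 + 1)) * (x0 \<bullet> x0 + 1)"
      using x0 by (intro mult_right_mono) (auto simp: \<delta>_def)
    also have "\<dots> = \<theta> / 4"
    proof -
      have "\<theta> / (4 * a) * a = \<theta> / 4" if "a > 0" for a using that by simp
      then show ?thesis using x0 by blast
    qed
    finally show ?thesis .
  qed
  have \<delta>M: "4 * \<delta> * M1 < m\<^sup>2"
  proof -
    have "4 * \<delta> * M1 \<le> 4 * (m\<^sup>2 / (8 * M1)) * M1"
      using M1 by (intro mult_right_mono mult_left_mono) (auto simp: \<delta>_def)
    also have "\<dots> < m\<^sup>2" using M1 m by simp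
    finally show ?thesis .
  qed
  \<comment> \<open>Only the first point is penalized at infinity; the second is confined by its
    distance to the first.\<close>
  define \<Phi> where "\<Phi> z w = U z - V w - q z w / (2 * \<epsilon>) - \<eta> / (T - fst z) - \<eta> / (T - fst w)
      - \<delta> * (snd z \<bullet> snd z)" for z w
  define W where "W = {0..<T} \<times> (UNIV :: (real ^ 'n) set)"
  have WT: "z \<in> {0..T} \<times> UNIV" and Wpos: "\<eta> / (T - fst z) > 0" if "z \<in> W" for z
    using that \<eta> by (auto simp: W_def)
  have base: "\<Phi> (t0, x0) (t0, x0) \<ge> \<theta> / 2"
  proof -
    have "\<theta> * a / 8 / a = \<theta> / 8" if "a > 0" for a using that by simp
    then have "\<eta> / (T - t0) = \<theta> / 8" using t0(2) unfolding \<eta>_def by (meson diff_gt_0_iff_gt)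
    moreover have "\<Phi> (t0, x0) (t0, x0) = \<theta> - \<eta> / (T - t0) - \<eta> / (T - t0) - \<delta> * (x0 \<bullet> x0)"
      by (simp add: \<Phi>_def q_def \<theta>_def)
    ultimately show ?thesis using \<delta>0 by linarith
  qed
  define T1 where "T1 = T - \<eta> / M1"
  define R where "R = sqrt (M1 / \<delta>)"
  have bounds: "dist z w \<le> D" "\<delta> * (snd z \<bullet> snd z) \<le> M1" "norm (snd z) \<le> R"
      "fst z \<le> T1" "fst w \<le> T1"
    if zw: "z \<in> W" "w \<in> W" and "\<Phi> z w \<ge> 0" for z w
  proof -
    let ?d = "dist z w"
    have g: "U z - V w \<le> M + C * ?d" using global WT zw by blast
    have nn: "\<delta> * (snd z \<bullet> snd z) \<ge> 0" using \<delta> by simp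
    note pos = Wpos[OF zw(1)] Wpos[OF zw(2)]
    have e: "?d\<^sup>2 / (2 * \<epsilon>) = ?d\<^sup>2 / (4 * \<epsilon>) + ?d\<^sup>2 / (4 * \<epsilon>)" by simp
    have "?d\<^sup>2 / (4 * \<epsilon>) \<le> M + C\<^sup>2 * \<epsilon>"
      using that(3) g young'[of ?d] nn pos e unfolding \<Phi>_def q by linarith
    then have "?d\<^sup>2 \<le> 4 * \<epsilon> * (M + C\<^sup>2 * \<epsilon>)" using \<epsilon> by (simp add: field_simps)
    then show "?d \<le> D" unfolding D_def by (rule real_le_rsqrt)
    have all: "\<eta> / (T - fst z) + \<eta> / (T - fst w) + \<delta> * (snd z \<bullet> snd z) \<le> M1"
      using that(3) g young[of ?d] unfolding \<Phi>_def q M1_def by linarith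
    then show x: "\<delta> * (snd z \<bullet> snd z) \<le> M1" using pos by linarith
    then have "(norm (snd z))\<^sup>2 \<le> M1 / \<delta>"
      using \<delta> by (simp add: power2_norm_eq_inner field_simps)
    then show "norm (snd z) \<le> R" unfolding R_def by (rule real_le_rsqrt)
    have "\<eta> / (T - fst z) \<le> M1" "\<eta> / (T - fst w) \<le> M1" using all pos nn by linarith+
    moreover have "fst z < T" "fst w < T" using zw by (auto simp: W_def)
    ultimately show "fst z \<le> T1" "fst w \<le> T1" using M1 by (auto simp: T1_def field_simps)
  qed
  \<comment> \<open>A compact set containing every pair with \<open>\<Phi> \<ge> 0\<close>. Since
    \<open>\<Phi>\<close> is at least \<open>\<theta> / 2\<close> at the doubled base point, a
    maximum over \<open>K\<close> is a maximum over all of \<open>W\<close>.\<close>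
  define K where "K = ({0..T1} \<times> cball (0 :: real ^ 'n) R) \<times> ({0..T1} \<times> cball (0 :: real ^ 'n) (R + D))"
  have inK: "(z, w) \<in> K" if zw: "z \<in> W" "w \<in> W" and "\<Phi> z w \<ge> 0" for z w
  proof -
    have "dist (snd z) (snd w) \<le> D" using dist_snd_le[of z w] bounds(1)[OF that] by linarith
    then have "norm (snd w) \<le> R + D"
      using bounds(3)[OF that] norm_triangle_ineq[of "snd z" "snd w - snd z"]
      by (simp add: dist_norm norm_minus_commute)
    then show ?thesis using bounds(3-5)[OF that] zw by (cases z; cases w) (auto simp: K_def W_def)
  qed
  have T1T: "T1 < T" using M1 \<eta> by (simp add: T1_def)
  have KW: "z \<in> W" "w \<in> W" if "(z, w) \<in> K" for z w using that T1T by (auto simp: K_def W_def)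
  have cont: "continuous_on K (\<lambda>(z, w). \<Phi> z w)"
  proof -
    have "fst ` K \<subseteq> {0..T} \<times> UNIV" "snd ` K \<subseteq> {0..T} \<times> UNIV"
      using WT KW by (metis image_subsetI prod.collapse)+
    then have "continuous_on K (\<lambda>p. U (fst p))" "continuous_on K (\<lambda>p. V (snd p))"
      by (auto intro: continuous_on_compose2[OF uniformly_continuous_imp_continuous[OF ucU]
            continuous_on_fst[OF continuous_on_id]]
          continuous_on_compose2[OF uniformly_continuous_imp_continuous[OF ucV]
            continuous_on_snd[OF continuous_on_id]])
    moreover have "T - fst (fst p) \<noteq> 0" "T - fst (snd p) \<noteq> 0" if "p \<in> K" for p
      using KW[of "fst p" "snd p"] that by (auto simp: W_def mem_Times_iff)
    ultimately show ?thesis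
      unfolding \<Phi>_def q_def case_prod_unfold using \<epsilon>
      by (intro continuous_intros) auto
  qed
  have t0W: "(t0, x0) \<in> W" using t0 by (auto simp: W_def)
  have "compact K" unfolding K_def by (intro compact_Times compact_Icc compact_cball)
  moreover have "K \<noteq> {}" using inK[OF t0W t0W] base \<theta> by auto
  ultimately obtain k where k: "k \<in> K" "\<And>k'. k' \<in> K \<Longrightarrow> (\<lambda>(z, w). \<Phi> z w) k' \<le> (\<lambda>(z, w). \<Phi> z w) k"
    using continuous_attains_sup[OF _ _ cont] by blast
  obtain t x s y where ktx: "k = ((t, x), (s, y))" by (metis prod.collapse)
  have W: "(t, x) \<in> W" "(s, y) \<in> W" using KW k(1) unfolding ktx by blast+
  have \<Phi>k: "\<Phi> (t, x) (s, y) \<ge> \<theta> / 2"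
    using k(2)[OF inK[OF t0W t0W]] base \<theta> by (simp add: ktx)
  have max: "\<Phi> z w \<le> \<Phi> (t, x) (s, y)" if "z \<in> W" "w \<in> W" for z w
  proof (cases "\<Phi> z w \<ge> 0")
    case True
    then show ?thesis using k(2)[OF inK[OF that]] by (simp add: ktx)
  next
    case False
    then show ?thesis using \<Phi>k \<theta> by linarith
  qed
  have "t \<noteq> 0 \<and> s \<noteq> 0"
  proof (rule ccontr)
    assume "\<not> (t \<noteq> 0 \<and> s \<noteq> 0)"
    then have "U (t, x) - V (s, y) \<le> \<theta> / 8 + C * dist (t, x) (s, y)"
      using initial[OF WT[OF W(1)] WT[OF W(2)]] by auto
    moreover have "\<delta> * (x \<bullet> x) \<ge> 0" using \<delta> by simp
    ultimately show False
      using \<Phi>k young[of "dist (t, x) (s, y)"] C2\<epsilon> Wpos[OF W(1)] Wpos[OF W(2)] \<theta>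
      unfolding \<Phi>_def q by simp
  qed
  then have ts: "0 < t" "t < T" "0 < s" "s < T" using W by (auto simp: W_def)
  define Wo where "Wo = {0<..<T} \<times> (UNIV :: (real ^ 'n) set)"
  have Wo: "open Wo" "Wo \<subseteq> W" "(t, x) \<in> Wo" "(s, y) \<in> Wo"
    using ts by (auto simp: Wo_def W_def intro: open_Times)
  define p where "p = (1 / \<epsilon>) *\<^sub>R (x - y)"
  \<comment> \<open>With the second point frozen, \<open>U\<close> minus the penalties has a maximum
    at \<open>(t, x)\<close>, and the subsolution test applies.\<close>
  have "(t - s) / \<epsilon> + \<eta> / (T - t)\<^sup>2 + H (p + (2 * \<delta>) *\<^sub>R x) \<le> 0"
  proof -
    let ?v = "\<lambda>(t, x). ((t - s)\<^sup>2 + (x - y) \<bullet> (x - y)) / (2 * \<epsilon>) + \<eta> / (T - t) + \<delta> * (x \<bullet> x)"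
    have "U z - ?v z \<le> U (t, x) - ?v (t, x)" if "z \<in> Wo" for z
      using max[of z "(s, y)"] that Wo W
      by (auto simp: \<Phi>_def q_def case_prod_unfold algebra_simps)
    then have "\<forall>\<^sub>F z in nhds (t, x). U z - ?v z \<le> U (t, x) - ?v (t, x)"
      using Wo by (metis (mono_tags, lifting) eventually_nhds)
    from sub[unfolded viscosity_subsolution_on_def, rule_format,
        OF C1_with_gradient_penalty _ this]
    show ?thesis using Wo(3) \<epsilon> by (simp add: p_def Wo_def)
  qed
  \<comment> \<open>With the first point frozen, \<open>V\<close> plus the penalties has a minimum
    at \<open>(s, y)\<close>; the test function carries reversed signs and has the same quadratic
    part of the gradient.\<close>
  moreover have "(t - s) / \<epsilon> - \<eta> / (T - s)\<^sup>2 + H p \<ge> 0"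
  proof -
    let ?v = "\<lambda>(s', y'). ((s' - t)\<^sup>2 + (y' - x) \<bullet> (y' - x)) / (2 * (- \<epsilon>)) + (- \<eta>) / (T - s') + 0 * (y' \<bullet> y')"
    let ?g = "\<lambda>(s', y'). ((s' - t) / (- \<epsilon>) + (- \<eta>) / (T - s')\<^sup>2, (1 / (- \<epsilon>)) *\<^sub>R (y' - x) + (2 * 0) *\<^sub>R y')"
    have "V z - ?v z \<ge> V (s, y) - ?v (s, y)" if "z \<in> Wo" for z
      using max[of "(t, x)" z] that Wo W
      by (auto simp: \<Phi>_def q_def case_prod_unfold algebra_simps power2_eq_square)
    then have ev: "\<forall>\<^sub>F z in nhds (s, y). V z - ?v z \<ge> V (s, y) - ?v (s, y)"
      using Wo by (metis (mono_tags, lifting) eventually_nhds)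
    have C1: "C1_with_gradient ({0<..<T} \<times> UNIV) ?v ?g"
      using \<epsilon> by (intro C1_with_gradient_penalty) auto
    have "fst (?g (s, y)) + H (snd (?g (s, y))) \<ge> 0"
      by (rule super[unfolded viscosity_supersolution_on_def, THEN spec, THEN spec, THEN mp, OF C1,
            THEN bspec, THEN mp, OF _ ev])
        (use Wo(4) in \<open>simp add: Wo_def\<close>)
    then have "(s - t) / (- \<epsilon>) + (- \<eta>) / (T - s)\<^sup>2 + H ((1 / (- \<epsilon>)) *\<^sub>R (y - x) + (2 * 0) *\<^sub>R y) \<ge> 0"
      by (simp only: prod.case fst_conv snd_conv)
    moreover have "(1 / (- \<epsilon>)) *\<^sub>R (y - x) + (2 * 0) *\<^sub>R y = p"
      by (simp add: p_def algebra_simps)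
    moreover have "(s - t) / (- \<epsilon>) = (t - s) / \<epsilon>" using \<epsilon> by (simp add: field_simps)
    ultimately show ?thesis by simp
  qed
  moreover have "\<bar>H (p + (2 * \<delta>) *\<^sub>R x) - H p\<bar> < \<eta> / T\<^sup>2"
  proof -
    have "\<Phi> (t, x) (s, y) \<ge> 0" using \<Phi>k \<theta> by simp
    note b = bounds[OF W this]
    have "norm (x - y) \<le> D" using b(1) dist_snd_le[of "(t, x)" "(s, y)"] by (simp add: dist_norm)
    then have p: "norm p \<le> D / \<epsilon>" using \<epsilon> by (simp add: p_def divide_right_mono)
    have "(norm ((2 * \<delta>) *\<^sub>R x))\<^sup>2 = 4 * \<delta> * (\<delta> * (x \<bullet> x))"
      using \<delta> by (simp add: power_mult_distrib power2_norm_eq_inner) (simp add: power2_eq_square)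
    also have "\<dots> \<le> 4 * \<delta> * M1" using b(2) \<delta> by (intro mult_left_mono) auto
    also have "\<dots> < m\<^sup>2" by (rule \<delta>M)
    finally have "(norm ((2 * \<delta>) *\<^sub>R x))\<^sup>2 < m\<^sup>2" .
    then have n: "norm ((2 * \<delta>) *\<^sub>R x) < m"
      by (rule power2_less_imp_less) (rule less_imp_le[OF m(1)])
    show ?thesis
    proof (rule H\<rho>)
      show "norm p \<le> D / \<epsilon> + 1" using p by simp
      show "norm (p + (2 * \<delta>) *\<^sub>R x) \<le> D / \<epsilon> + 1"
        using norm_triangle_ineq[of p "(2 * \<delta>) *\<^sub>R x"] p n m by linarith
      show "dist (p + (2 * \<delta>) *\<^sub>R x) p < \<rho>" using n m by (simp add: dist_norm)
    qed
  qed
  \<comment> \<open>Subtracting the two tests bounds the sum of both barrier derivatives by a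
    difference of \<open>H\<close> that is below \<open>\<eta> / T\<^sup>2\<close>, although the
    first derivative alone is at least that large.\<close>
  moreover have "\<eta> / T\<^sup>2 \<le> \<eta> / (T - t)\<^sup>2" "\<eta> / (T - s)\<^sup>2 > 0"
    using ts \<eta> by (auto intro!: divide_left_mono power_mono mult_pos_pos)
  ultimately show False by linarith
qed

subsection \<open>Hopf--Lax formula\<close>

text \<open>The velocity \<open>q\<close> is used as parameter instead of the foot point \<open>x - t q\<close>, so that the
  formula also makes sense at \<open>t = 0\<close>.\<close>

definition hopf_lax :: "('a::real_normed_vector \<Rightarrow> real) \<Rightarrow> ('a \<Rightarrow> real) \<Rightarrow> real \<times> 'a \<Rightarrow> real" where
  "hopf_lax L u0 = (\<lambda>(t, x). INF q. u0 (x - t *\<^sub>R q) + t * L q)"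

text \<open>Differentiating a test function along a ray of velocity \<open>q\<close> turns the
  variational inequalities for \<open>hopf_lax\<close> into inequalities for its gradient.\<close>

lemma GDERIV_backward_ray:
  assumes "GDERIV v (t, x) :> g"
  shows "((\<lambda>h. (v (t, x) - v (t - h, x - h *\<^sub>R q)) / h) \<longlongrightarrow> fst g + q \<bullet> snd g) (at_right 0)"
proof -
  have "((\<lambda>h::real. (t - h, x - h *\<^sub>R q)) has_derivative (\<lambda>h. (- h, - (h *\<^sub>R q)))) (at 0)"
    by (auto intro!: derivative_eq_intros)
  from has_derivative_compose[OF this, of v "\<lambda>h. h \<bullet> g"]
  have "((\<lambda>h. v (t - h, x - h *\<^sub>R q)) has_derivative (\<lambda>h. (- h, - (h *\<^sub>R q)) \<bullet> g)) (at 0)"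
    using assms by (simp add: gderiv_def)
  then have "((\<lambda>h. v (t - h, x - h *\<^sub>R q)) has_real_derivative - (fst g + q \<bullet> snd g)) (at 0)"
    unfolding has_field_derivative_def
    by (rule has_derivative_eq_rhs) (auto simp: inner_prod_def fun_eq_iff algebra_simps)
  then have "((\<lambda>h. (v (t - h, x - h *\<^sub>R q) - v (t, x)) / h) \<longlongrightarrow> - (fst g + q \<bullet> snd g)) (at 0)"
    by (simp add: has_field_derivative_iff)
  then have "((\<lambda>h. - ((v (t - h, x - h *\<^sub>R q) - v (t, x)) / h)) \<longlongrightarrow> - (- (fst g + q \<bullet> snd g))) (at 0)"
    by (rule tendsto_minus)
  then show ?thesis
    by (simp add: minus_divide_left filterlim_at_split del: minus_add_distrib)
qed

lemma eventually_backward_ray: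
  assumes "\<forall>\<^sub>F w in nhds (t::real, x::'a::real_normed_vector). P w"
  shows "\<forall>\<^sub>F h in at_right 0. P (t - h, x - h *\<^sub>R q)"
proof -
  have "((\<lambda>h::real. (t - h, x - h *\<^sub>R q)) \<longlongrightarrow> (t - 0, x - 0 *\<^sub>R q)) (at_right 0)"
    by (intro tendsto_intros)
  then have "filterlim (\<lambda>h::real. (t - h, x - h *\<^sub>R q)) (nhds (t, x)) (at_right 0)" by simp
  then show ?thesis using assms by (auto simp: filterlim_iff)
qed

locale hopf_lax_data =
  fixes L :: "'a::euclidean_space \<Rightarrow> real" and c K :: real and u0 :: "'a \<Rightarrow> real"
  assumes L_convex: "convex_on UNIV L"
    and L_cont: "continuous_on UNIV L"
    and L_zero: "L 0 = 0"
    and L_coercive: "\<And>q. c * (norm q)\<^sup>2 \<le> L q"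
    and c_pos: "c > 0"
    and u0_lipschitz: "K-lipschitz_on UNIV u0"
begin

text \<open>Speed beyond which moving cannot beat rest: the cost \<open>c * (norm q)\<^sup>2\<close>
  then exceeds the possible gain \<open>K * norm q\<close>.\<close>

definition R :: real where "R = K / c"

lemma K_nonneg: "K \<ge> 0"
  using u0_lipschitz lipschitz_on_nonneg by blast

lemma R_nonneg: "R \<ge> 0"
  using K_nonneg c_pos by (simp add: R_def)

lemma u0_diff: "\<bar>u0 x - u0 y\<bar> \<le> K * norm (x - y)"
  using lipschitz_onD[OF u0_lipschitz, of x y] by (simp add: dist_real_def dist_norm)

text \<open>A minimum over the ball of radius \<open>R\<close> exists by compactness. It is global,
  because outside the ball no velocity does better than \<open>q = 0\<close>.\<close>

lemma hopf_lax_attained: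
  assumes "t \<ge> 0"
  obtains q where "norm q \<le> R" "hopf_lax L u0 (t, x) = u0 (x - t *\<^sub>R q) + t * L q"
    "\<And>q'. hopf_lax L u0 (t, x) \<le> u0 (x - t *\<^sub>R q') + t * L q'"
proof -
  let ?f = "\<lambda>q. u0 (x - t *\<^sub>R q) + t * L q"
  have "continuous_on (cball 0 R) ?f"
    by (intro continuous_intros continuous_on_compose2[OF L_cont]
        continuous_on_compose2[OF lipschitz_on_continuous_on[OF u0_lipschitz]]) auto
  then obtain q where q: "norm q \<le> R" "\<And>q'. norm q' \<le> R \<Longrightarrow> ?f q \<le> ?f q'"
    using continuous_attains_inf[of "cball (0::'a) R" ?f] R_nonneg by auto
  have min: "?f q \<le> ?f q'" for q'
  proof (cases "norm q' \<le> R")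
    case False
    then have "K \<le> c * norm q'" using c_pos by (simp add: R_def field_simps)
    then have "K * norm q' \<le> c * (norm q')\<^sup>2"
      using mult_right_mono[of K "c * norm q'" "norm q'"] by (simp add: power2_eq_square)
    then have "K * norm q' \<le> L q'" using L_coercive[of q'] by linarith
    then have "t * (K * norm q') \<le> t * L q'" using assms by (rule mult_left_mono)
    moreover have "\<bar>u0 (x - t *\<^sub>R q') - u0 x\<bar> \<le> t * (K * norm q')"
      using u0_diff[of "x - t *\<^sub>R q'" x] assms by (simp add: mult_ac)
    moreover have "?f q \<le> u0 x" using q(2)[of 0] R_nonneg by (simp add: L_zero)
    ultimately show ?thesis by linarith
  qed (use q in auto)
  have eq: "hopf_lax L u0 (t, x) = ?f q"
    unfolding hopf_lax_def by (auto intro!: cInf_eq_minimum min)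
  show ?thesis using that[OF q(1) eq] min eq by simp
qed

lemma hopf_lax_le:
  "t \<ge> 0 \<Longrightarrow> hopf_lax L u0 (t, x) \<le> u0 (x - t *\<^sub>R q) + t * L q"
  by (metis hopf_lax_attained)

lemma hopf_lax_zero: "hopf_lax L u0 (0, x) = u0 x"
  by (rule hopf_lax_attained[of 0 x]) auto

text \<open>An optimal velocity for one point is used as a competitor at the other. Being bounded by
  \<open>R\<close>, it moves the foot point by at most \<open>d + d * R\<close> and changes the
  running cost by at most \<open>d * b\<close>.\<close>

lemma hopf_lax_lipschitz:
  obtains M where "M-lipschitz_on ({0..} \<times> UNIV) (hopf_lax L u0)"
proof -
  have "bounded (L ` cball 0 R)"
    by (intro compact_imp_bounded compact_continuous_image continuous_on_subset[OF L_cont]) auto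
  then obtain b where b: "\<And>q. norm q \<le> R \<Longrightarrow> \<bar>L q\<bar> \<le> b"
    unfolding bounded_iff by (metis imageI mem_cball_0 real_norm_def)
  have b0: "b \<ge> 0" using b[of 0] R_nonneg by simp
  have *: "hopf_lax L u0 z \<le> hopf_lax L u0 w + (K * (1 + R) + b) * dist z w"
    if "z \<in> {0..} \<times> UNIV" "w \<in> {0..} \<times> UNIV" for z w
  proof -
    obtain t x s y where tx: "z = (t, x)" and sy: "w = (s, y)" by (metis prod.collapse)
    have zw: "z = (t, x)" "w = (s, y)" "t \<ge> 0" "s \<ge> 0" using that tx sy by auto
    obtain q where q: "norm q \<le> R" "hopf_lax L u0 (s, y) = u0 (y - s *\<^sub>R q) + s * L q"
      using hopf_lax_attained[OF zw(4)] by metis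
    define d where "d = dist z w"
    have d: "norm (x - y) \<le> d" "\<bar>t - s\<bar> \<le> d"
      using dist_snd_le[of z w] dist_fst_le[of z w]
      by (auto simp: zw d_def dist_norm)
    have "hopf_lax L u0 z \<le> u0 (x - t *\<^sub>R q) + t * L q" unfolding zw by (rule hopf_lax_le[OF zw(3)])
    moreover have "u0 (x - t *\<^sub>R q) - u0 (y - s *\<^sub>R q) \<le> K * (d + d * R)"
    proof -
      have "norm ((x - t *\<^sub>R q) - (y - s *\<^sub>R q)) = norm ((x - y) - (t - s) *\<^sub>R q)"
        by (simp add: algebra_simps)
      also have "\<dots> \<le> norm (x - y) + \<bar>t - s\<bar> * norm q"
        using norm_triangle_ineq4[of "x - y" "(t - s) *\<^sub>R q"] by simp
      also have "\<dots> \<le> d + d * R" using d q R_nonneg by (intro add_mono mult_mono) auto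
      finally have "K * norm ((x - t *\<^sub>R q) - (y - s *\<^sub>R q)) \<le> K * (d + d * R)"
        using K_nonneg by (rule mult_left_mono)
      then show ?thesis using u0_diff[of "x - t *\<^sub>R q" "y - s *\<^sub>R q"] by linarith
    qed
    moreover have "t * L q - s * L q \<le> d * b"
    proof -
      have "t * L q - s * L q \<le> \<bar>t - s\<bar> * \<bar>L q\<bar>"
        by (simp add: abs_mult[symmetric] left_diff_distrib[symmetric])
      also have "\<dots> \<le> d * b" using d b[OF q(1)] b0 by (intro mult_mono) auto
      finally show ?thesis .
    qed
    ultimately show ?thesis using q(2) unfolding zw(2) d_def by (simp add: algebra_simps)
  qed
  have "(K * (1 + R) + b)-lipschitz_on ({0..} \<times> UNIV) (hopf_lax L u0)"
  proof (rule lipschitz_onI)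
    fix z w :: "real \<times> 'a" assume zw: "z \<in> {0..} \<times> UNIV" "w \<in> {0..} \<times> UNIV"
    show "dist (hopf_lax L u0 z) (hopf_lax L u0 w) \<le> (K * (1 + R) + b) * dist z w"
      using *[OF zw] *[OF zw(2,1)] by (simp add: dist_real_def abs_le_iff dist_commute)
  qed (use K_nonneg R_nonneg b0 in auto)
  then show ?thesis by (rule that)
qed

text \<open>Velocity \<open>r\<close> for time \<open>t - h\<close> followed by \<open>q\<close> for
  time \<open>h\<close> reaches the same point as their time average \<open>m\<close> throughout; by
  convexity of \<open>L\<close> the straight path is not more expensive.\<close>

lemma hopf_lax_dynamic_programming:
  assumes "0 \<le> h" "h < t"
  shows "hopf_lax L u0 (t, x) \<le> hopf_lax L u0 (t - h, x - h *\<^sub>R q) + h * L q"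
proof -
  obtain r where r: "hopf_lax L u0 (t - h, x - h *\<^sub>R q) =
      u0 (x - h *\<^sub>R q - (t - h) *\<^sub>R r) + (t - h) * L r"
    using hopf_lax_attained[of "t - h" "x - h *\<^sub>R q"] assms by auto
  define k where "k = h / t"
  have k: "0 \<le> k" "k \<le> 1" "t * k = h" using assms by (auto simp: k_def)
  define m where "m = (1 - k) *\<^sub>R r + k *\<^sub>R q"
  have tk: "t * (1 - k) = t - h" using k(3) by (simp add: algebra_simps)
  have "t *\<^sub>R m = (t - h) *\<^sub>R r + h *\<^sub>R q"
    by (simp add: m_def scaleR_add_right k(3) tk)
  then have foot: "x - t *\<^sub>R m = x - h *\<^sub>R q - (t - h) *\<^sub>R r" by (simp add: algebra_simps)
  have "L m \<le> (1 - k) * L r + k * L q"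
    unfolding m_def using convex_onD[OF L_convex k(1,2)] by simp
  then have "t * L m \<le> t * ((1 - k) * L r + k * L q)" using assms by (intro mult_left_mono) auto
  also have "\<dots> = (t - h) * L r + h * L q"
    by (simp add: distrib_left mult.assoc[symmetric] k(3) tk)
  finally show ?thesis using hopf_lax_le[of t x m] assms r foot by simp
qed

end

text \<open>For the subsolution property, dynamic programming is applied along the velocity
  attaining equality in Young's inequality. For the supersolution property, one goes back along the
  optimal ray, whose foot point stays the same.\<close>

theorem hopf_lax_viscosity_solution:
  fixes H L :: "real ^ 'n \<Rightarrow> real"
  assumes "hopf_lax_data L c K u0"
    and young: "\<And>p q. q \<bullet> p \<le> H p + L q"
    and dual: "\<And>p. \<exists>q. q \<bullet> p = H p + L q"
  shows "viscosity_solution H T u0 (hopf_lax L u0)"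
proof -
  interpret hopf_lax_data L c K u0 by fact
  let ?w = "hopf_lax L u0"
  show ?thesis
    unfolding viscosity_solution_def
  proof (intro conjI allI)
    obtain M where "M-lipschitz_on ({0..} \<times> UNIV) ?w" using hopf_lax_lipschitz by blast
    then have "M-lipschitz_on ({0..T} \<times> UNIV) ?w" by (rule lipschitz_on_subset) auto
    then show "uniformly_continuous_on ({0..T} \<times> UNIV) ?w"
      by (rule lipschitz_on_uniformly_continuous)
    show "?w (0, x) = u0 x" for x by (rule hopf_lax_zero)
    show "viscosity_subsolution_on ({0<..<T} \<times> UNIV) H ?w"
      unfolding viscosity_subsolution_on_def
    proof (intro allI impI ballI)
      fix v g and z :: "real \<times> (real ^ 'n)"
      assume C1: "C1_with_gradient ({0<..<T} \<times> UNIV) v g" and z: "z \<in> {0<..<T} \<times> UNIV"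
        and max: "\<forall>\<^sub>F y in nhds z. ?w y - v y \<le> ?w z - v z"
      obtain t x where tx: "z = (t, x)" "0 < t" using z by auto
      obtain q where q: "q \<bullet> snd (g z) = H (snd (g z)) + L q" using dual by blast
      have G: "GDERIV v (t, x) :> g z" using C1 z tx by (auto simp: C1_with_gradient_def)
      have "fst (g z) + q \<bullet> snd (g z) \<le> L q"
      proof (rule tendsto_upperbound[OF GDERIV_backward_ray[OF G]])
        have "\<forall>\<^sub>F h in at_right 0. h < t \<and> 0 < h"
          using tx(2) eventually_at_right_less[of "0::real"] eventually_at_right_real[of 0 t]
          by (auto elim: eventually_mono)
        with eventually_backward_ray[OF max[unfolded tx], of q]
        show "\<forall>\<^sub>F h in at_right 0. (v (t, x) - v (t - h, x - h *\<^sub>R q)) / h \<le> L q"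
        proof eventually_elim
          case (elim h)
          then show ?case
            using hopf_lax_dynamic_programming[of h t x q] by (simp add: field_simps)
        qed
      qed simp
      then show "fst (g z) + H (snd (g z)) \<le> 0" using q by linarith
    qed
    show "viscosity_supersolution_on ({0<..<T} \<times> UNIV) H ?w"
      unfolding viscosity_supersolution_on_def
    proof (intro allI impI ballI)
      fix v g and z :: "real \<times> (real ^ 'n)"
      assume C1: "C1_with_gradient ({0<..<T} \<times> UNIV) v g" and z: "z \<in> {0<..<T} \<times> UNIV"
        and min: "\<forall>\<^sub>F y in nhds z. ?w y - v y \<ge> ?w z - v z"
      obtain t x where tx: "z = (t, x)" "0 < t" using z by auto
      obtain q where q: "?w (t, x) = u0 (x - t *\<^sub>R q) + t * L q"
        using hopf_lax_attained[of t x] tx by auto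
      have G: "GDERIV v (t, x) :> g z" using C1 z tx by (auto simp: C1_with_gradient_def)
      have "fst (g z) + q \<bullet> snd (g z) \<ge> L q"
      proof (rule tendsto_lowerbound[OF GDERIV_backward_ray[OF G]])
        have "\<forall>\<^sub>F h in at_right 0. h < t \<and> 0 < h"
          using tx(2) eventually_at_right_less[of "0::real"] eventually_at_right_real[of 0 t]
          by (auto elim: eventually_mono)
        with eventually_backward_ray[OF min[unfolded tx], of q]
        show "\<forall>\<^sub>F h in at_right 0. L q \<le> (v (t, x) - v (t - h, x - h *\<^sub>R q)) / h"
        proof eventually_elim
          case (elim h)
          have "?w (t - h, x - h *\<^sub>R q) \<le> u0 (x - h *\<^sub>R q - (t - h) *\<^sub>R q) + (t - h) * L q"
            using elim by (intro hopf_lax_le) auto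
          also have "x - h *\<^sub>R q - (t - h) *\<^sub>R q = x - t *\<^sub>R q" by (simp add: algebra_simps)
          finally show ?case using elim q by (simp add: field_simps)
        qed
      qed simp
      then show "fst (g z) + H (snd (g z)) \<ge> 0" using young[of q "snd (g z)"] by linarith
    qed
  qed
qed

subsection \<open>Projection onto semiconcave functions\<close>

text \<open>This form of semiconcavity passes to averages and limits without any appeal to supporting
  hyperplanes.\<close>

definition has_supergradients :: "('a::real_inner \<Rightarrow> real) \<Rightarrow> ('a \<Rightarrow> real) \<Rightarrow> bool" where
  "has_supergradients Q \<psi> \<longleftrightarrow> (\<forall>x. \<exists>p. \<forall>y. \<psi> y \<le> \<psi> x + p \<bullet> (y - x) + Q (y - x))"

section \<open>Squared L2 norms and pointwise control of Lipschitz functions\<close>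

definition sq_int :: "('a::euclidean_space \<Rightarrow> real) \<Rightarrow> ennreal" where
  "sq_int f = (\<integral>\<^sup>+ x. ennreal ((f x)\<^sup>2) \<partial>lborel)"

text \<open>Chebyshev's inequality on a ball; the volume is taken at the origin so that the bound
  does not depend on the centre.\<close>

lemma sq_int_ge_ball:
  fixes f :: "'a::euclidean_space \<Rightarrow> real"
  assumes m: "m \<ge> 0" and r: "r \<ge> 0" and ge: "\<And>y. y \<in> ball z r \<Longrightarrow> m \<le> \<bar>f y\<bar>"
  shows "ennreal (m\<^sup>2 * measure lborel (ball (0::'a) r)) \<le> sq_int f"
proof -
  have "measure lborel (ball (0::'a) r) = measure lborel (ball z r)" using r by (simp add: content_ball)
  moreover have "emeasure lborel (ball z r) = ennreal (measure lborel (ball z r))"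
    using emeasure_lborel_ball_finite[of z r] by (simp add: emeasure_eq_ennreal_measure top.not_eq_extremum)
  ultimately have "ennreal (m\<^sup>2 * measure lborel (ball (0::'a) r)) = ennreal (m\<^sup>2) * emeasure lborel (ball z r)"
    by (simp add: ennreal_mult)
  also have "\<dots> = (\<integral>\<^sup>+ y. ennreal (m\<^sup>2) * indicator (ball z r) y \<partial>lborel)"
    by (simp add: nn_integral_cmult_indicator)
  also have "\<dots> \<le> sq_int f"
    unfolding sq_int_def
  proof (rule nn_integral_mono)
    fix y
    show "ennreal (m\<^sup>2) * indicator (ball z r) y \<le> ennreal ((f y)\<^sup>2)"
    proof (cases "y \<in> ball z r")
      case True
      then have "m\<^sup>2 \<le> (f y)\<^sup>2" using ge m by (metis abs_of_nonneg abs_le_square_iff)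
      then show ?thesis using True by (simp add: ennreal_leI)
    qed simp
  qed
  finally show ?thesis .
qed

lemma sq_int_cmult:
  assumes [measurable]: "f \<in> borel_measurable borel"
  shows "sq_int (\<lambda>x. c * f x) = ennreal (c\<^sup>2) * sq_int f"
  unfolding sq_int_def by (simp add: power_mult_distrib ennreal_mult nn_integral_cmult)

lemma sq_int_parallelogram:
  assumes [measurable]: "f \<in> borel_measurable borel" "g \<in> borel_measurable borel"
  shows "sq_int (\<lambda>x. f x + g x) + sq_int (\<lambda>x. f x - g x) = 2 * sq_int f + 2 * sq_int g"
proof -
  have "ennreal ((f x + g x)\<^sup>2) + ennreal ((f x - g x)\<^sup>2) =
      2 * ennreal ((f x)\<^sup>2) + 2 * ennreal ((g x)\<^sup>2)" for x
  proof -
    have "ennreal ((f x + g x)\<^sup>2) + ennreal ((f x - g x)\<^sup>2) = ennreal ((f x + g x)\<^sup>2 + (f x - g x)\<^sup>2)"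
      by simp
    also have "(f x + g x)\<^sup>2 + (f x - g x)\<^sup>2 = 2 * (f x)\<^sup>2 + 2 * (g x)\<^sup>2"
      by (simp add: power2_eq_square algebra_simps)
    finally show ?thesis by (simp add: ennreal_mult)
  qed
  then show ?thesis unfolding sq_int_def
    by (simp add: nn_integral_add[symmetric] nn_integral_cmult[symmetric])
qed

lemma lipschitz_imp_borel_measurable:
  fixes f :: "'a::euclidean_space \<Rightarrow> real"
  shows "L-lipschitz_on UNIV f \<Longrightarrow> f \<in> borel_measurable borel"
  by (intro borel_measurable_continuous_onI lipschitz_on_continuous_on)

text \<open>A value of modulus at least \<open>m\<close> at one point persists as
  \<open>m / 2\<close> on a ball whose radius depends only on \<open>m\<close> and \<open>L\<close>.
  Thus L2 smallness gives uniform smallness under a common Lipschitz constant.\<close>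

lemma lipschitz_small_sq_int:
  assumes m: "m > 0"
  obtains \<eta> where "\<eta> > 0"
    "\<And>(f::'a::euclidean_space \<Rightarrow> real) x. L-lipschitz_on UNIV f \<Longrightarrow> sq_int f < ennreal \<eta> \<Longrightarrow> \<bar>f x\<bar> < m"
proof -
  define r where "r = m / (2 * (\<bar>L\<bar> + 1))"
  have r: "r > 0" using m by (simp add: r_def)
  have Lr: "\<bar>L\<bar> * r \<le> m / 2"
  proof -
    have "\<bar>L\<bar> * r \<le> (\<bar>L\<bar> + 1) * r" using r by (simp add: algebra_simps)
    also have "\<dots> = m / 2" by (simp add: r_def field_simps)
    finally show ?thesis .
  qed
  define \<eta> where "\<eta> = (m / 2)\<^sup>2 * measure lborel (ball (0::'a) r)"
  show ?thesis
  proof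
    show "\<eta> > 0" using r m by (simp add: \<eta>_def content_ball)
    fix f :: "'a \<Rightarrow> real" and x
    assume L: "L-lipschitz_on UNIV f" and small: "sq_int f < ennreal \<eta>"
    show "\<bar>f x\<bar> < m"
    proof (rule ccontr)
      assume large: "\<not> \<bar>f x\<bar> < m"
      have "m / 2 \<le> \<bar>f y\<bar>" if "y \<in> ball x r" for y
      proof -
        have "\<bar>f x - f y\<bar> \<le> L * dist x y" using lipschitz_onD[OF L, of x y] by (simp add: dist_real_def)
        also have "\<dots> \<le> \<bar>L\<bar> * r" using that by (intro mult_mono) auto
        finally show ?thesis using Lr large by linarith
      qed
      then have "ennreal \<eta> \<le> sq_int f"
        unfolding \<eta>_def using m r by (intro sq_int_ge_ball) auto
      then show False using small by simp
    qed
  qed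
qed

lemma lipschitz_sq_int_zero:
  fixes f :: "'a::euclidean_space \<Rightarrow> real"
  assumes "L-lipschitz_on UNIV f" "sq_int f = 0"
  shows "f x = 0"
proof (rule ccontr)
  assume "f x \<noteq> 0"
  then have "\<bar>f x\<bar> > 0" by simp
  then obtain \<eta> where \<eta>: "\<eta> > 0"
    "\<And>(g::'a \<Rightarrow> real) y. L-lipschitz_on UNIV g \<Longrightarrow> sq_int g < ennreal \<eta> \<Longrightarrow> \<bar>g y\<bar> < \<bar>f x\<bar>"
    by (rule lipschitz_small_sq_int) (rule that, auto)
  have "\<bar>f x\<bar> < \<bar>f x\<bar>" by (rule \<eta>(2)[OF assms(1)]) (simp add: assms(2) \<eta>(1))
  then show False by simp
qed

section \<open>Stability of supergradients and a priori bounds\<close>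

lemma has_supergradients_average:
  assumes "has_supergradients Q f" "has_supergradients Q g"
  shows "has_supergradients Q (\<lambda>x. (f x + g x) / 2)"
  unfolding has_supergradients_def
proof
  fix x
  obtain p where p: "\<And>y. f y \<le> f x + p \<bullet> (y - x) + Q (y - x)"
    using assms(1) unfolding has_supergradients_def by blast
  obtain r where r: "\<And>y. g y \<le> g x + r \<bullet> (y - x) + Q (y - x)"
    using assms(2) unfolding has_supergradients_def by blast
  show "\<exists>p. \<forall>y. (f y + g y) / 2 \<le> (f x + g x) / 2 + p \<bullet> (y - x) + Q (y - x)"
  proof (intro exI[of _ "(1/2) *\<^sub>R (p + r)"] allI)
    fix y
    show "(f y + g y) / 2 \<le> (f x + g x) / 2 + ((1/2) *\<^sub>R (p + r)) \<bullet> (y - x) + Q (y - x)"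
      using p[of y] r[of y] by (simp add: inner_add_left field_simps)
  qed
qed

text \<open>A unit step against the direction of \<open>p\<close> lowers the upper bound by
  \<open>norm p\<close>, while the function can drop by at most \<open>2 * K\<close>.\<close>

lemma supergradient_bound:
  assumes p: "\<And>y. \<psi> y \<le> \<psi> x + p \<bullet> (y - x) + Q (y - x)"
    and Q: "\<And>h. Q h \<le> C * (norm h)\<^sup>2" and C: "C \<ge> 0" and K: "\<And>x. \<bar>\<psi> x\<bar> \<le> K"
  shows "norm p \<le> 2 * K + C"
proof (cases "p = 0")
  case True
  then show ?thesis using C K[of x] by auto
next
  case False
  define y where "y = x - (1 / norm p) *\<^sub>R p"
  have "p \<bullet> (y - x) = - norm p" using False
    by (simp add: y_def dot_square_norm power2_eq_square)
  moreover have "norm (y - x) = 1" using False by (simp add: y_def)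
  ultimately show ?thesis using p[of y] Q[of "y - x"] K[of x] K[of y] by (simp add: abs_le_iff)
qed

text \<open>Within distance 1 the bounded supergradient controls the increment and the quadratic
  error is at most linear; beyond distance 1 the bound \<open>2 * K\<close> suffices.\<close>

lemma has_supergradients_lipschitz:
  fixes \<psi> :: "'a::real_inner \<Rightarrow> real"
  assumes sg: "has_supergradients Q \<psi>"
    and Q: "\<And>h. Q h \<le> C * (norm h)\<^sup>2" and C: "C \<ge> 0" and K: "\<And>x. \<bar>\<psi> x\<bar> \<le> K"
  shows "(2 * K + 2 * C)-lipschitz_on UNIV \<psi>"
proof -
  have K0: "K \<ge> 0" using K[of 0] by simp
  have *: "\<psi> y - \<psi> x \<le> (2 * K + 2 * C) * norm (y - x)" for x y
  proof (cases "norm (y - x) \<le> 1")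
    case True
    obtain p where p: "\<And>y. \<psi> y \<le> \<psi> x + p \<bullet> (y - x) + Q (y - x)"
      using sg unfolding has_supergradients_def by blast
    have "p \<bullet> (y - x) \<le> norm p * norm (y - x)" by (rule norm_cauchy_schwarz)
    also have "\<dots> \<le> (2 * K + C) * norm (y - x)"
      using supergradient_bound[OF p Q C K] by (intro mult_right_mono) auto
    finally have "p \<bullet> (y - x) \<le> (2 * K + C) * norm (y - x)" .
    moreover have "C * (norm (y - x))\<^sup>2 \<le> C * norm (y - x)"
      using True C mult_left_mono[of "norm (y - x)" 1 "norm (y - x)"]
      by (intro mult_left_mono) (auto simp: power2_eq_square)
    ultimately show ?thesis using p[of y] Q[of "y - x"] by (simp add: algebra_simps)
  next
    case False
    have "\<psi> y - \<psi> x \<le> 2 * K" using K[of x] K[of y] by linarith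
    also have "\<dots> \<le> (2 * K + 2 * C) * 1" using C by simp
    also have "\<dots> \<le> (2 * K + 2 * C) * norm (y - x)"
      using False C K0 by (intro mult_left_mono) auto
    finally show ?thesis .
  qed
  show ?thesis
  proof (rule lipschitz_onI)
    fix x y
    show "dist (\<psi> x) (\<psi> y) \<le> (2 * K + 2 * C) * dist x y"
      using *[of x y] *[of y x] by (simp add: dist_real_def dist_norm norm_minus_commute abs_le_iff)
  qed (use K0 C in simp)
qed

text \<open>At each point the supergradients of the sequence are bounded, so a subsequence
  converges, and its limit is a supergradient of the limit function.\<close>

lemma has_supergradients_limit:
  fixes f :: "nat \<Rightarrow> 'a::euclidean_space \<Rightarrow> real"
  assumes sg: "\<And>n. has_supergradients Q (f n)"
    and Q: "\<And>h. Q h \<le> C * (norm h)\<^sup>2" and C: "C \<ge> 0" and K: "\<And>n x. \<bar>f n x\<bar> \<le> K"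
    and lim: "\<And>x. (\<lambda>n. f n x) \<longlonglongrightarrow> \<psi> x"
  shows "has_supergradients Q \<psi>"
  unfolding has_supergradients_def
proof
  fix x
  have "\<forall>n. \<exists>p. \<forall>y. f n y \<le> f n x + p \<bullet> (y - x) + Q (y - x)"
    using sg unfolding has_supergradients_def by blast
  then obtain p where p: "\<And>n y. f n y \<le> f n x + p n \<bullet> (y - x) + Q (y - x)" by metis
  have "norm (p n) \<le> 2 * K + C" for n
    by (rule supergradient_bound[OF p Q C K])
  then have "bounded (range p)" unfolding bounded_iff by blast
  then obtain l r where r: "strict_mono (r :: nat \<Rightarrow> nat)" "(p \<circ> r) \<longlonglongrightarrow> l"
    using bounded_imp_convergent_subsequence by blast
  have sub: "(\<lambda>n. f (r n) y) \<longlonglongrightarrow> \<psi> y" for y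
    using LIMSEQ_subseq_LIMSEQ[OF lim r(1)] by (simp add: o_def)
  have "\<psi> y \<le> \<psi> x + l \<bullet> (y - x) + Q (y - x)" for y
  proof (rule LIMSEQ_le[OF sub])
    show "(\<lambda>n. f (r n) x + p (r n) \<bullet> (y - x) + Q (y - x)) \<longlonglongrightarrow> \<psi> x + l \<bullet> (y - x) + Q (y - x)"
      using r(2) by (intro tendsto_intros sub) (simp add: o_def)
  qed (use p in auto)
  then show "\<exists>p. \<forall>y. \<psi> y \<le> \<psi> x + p \<bullet> (y - x) + Q (y - x)" by blast
qed

text \<open>A very negative value forces the function to be very negative on half a ball, because of
  the supergradient there; a very large value forces it to be large on a ball, because the
  function is bounded below and almost midpoint concave.\<close>

lemma has_supergradients_sq_int_bounded:
  assumes Q: "\<And>h. Q h \<le> C * (norm h)\<^sup>2" and C: "C \<ge> 0"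
  obtains K where "\<And>(\<psi>::'a::euclidean_space \<Rightarrow> real) x.
    has_supergradients Q \<psi> \<Longrightarrow> sq_int \<psi> \<le> ennreal e \<Longrightarrow> \<bar>\<psi> x\<bar> \<le> K"
proof -
  define v where "v = measure lborel (ball (0::'a) (1/2))"
  have v: "v > 0" by (simp add: v_def content_ball)
  \<comment> \<open>By Chebyshev, \<open>k\<close> is the largest height that a function of squared
    norm at most \<open>e\<close> can keep on a ball of radius 1/2.\<close>
  define k where "k = sqrt (\<bar>e\<bar> / v)"
  have k0: "k \<ge> 0" using v by (simp add: k_def)
  have k: "m \<le> k" if "m \<ge> 0" "\<And>y. y \<in> ball z (1/2) \<Longrightarrow> m \<le> \<bar>\<psi> y\<bar>" "sq_int \<psi> \<le> ennreal e"
    for m z and \<psi> :: "'a \<Rightarrow> real"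
  proof -
    have "ennreal (m\<^sup>2 * v) \<le> sq_int \<psi>"
      unfolding v_def by (rule sq_int_ge_ball[OF that(1) _ that(2)]) auto
    also have "\<dots> \<le> ennreal \<bar>e\<bar>"
      using that(3) ennreal_leI[of e "\<bar>e\<bar>"] by (meson abs_ge_self order_trans)
    finally have "m\<^sup>2 * v \<le> \<bar>e\<bar>" by (simp add: ennreal_le_iff)
    then have "m\<^sup>2 \<le> \<bar>e\<bar> / v" using v by (simp add: field_simps)
    then show ?thesis unfolding k_def by (rule real_le_rsqrt)
  qed
  have Q1: "Q h \<le> C" if "norm h \<le> 1" for h
  proof -
    have "C * (norm h)\<^sup>2 \<le> C * 1" using that C by (intro mult_left_mono) (auto simp: power_le_one)
    then show ?thesis using Q[of h] by simp
  qed
  show ?thesis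
  proof
    fix \<psi> :: "'a \<Rightarrow> real" and x
    assume sg: "has_supergradients Q \<psi>" and e: "sq_int \<psi> \<le> ennreal e"
    have lower: "- \<psi> x \<le> C + k" for x
    proof (cases "- \<psi> x - C \<ge> 0")
      case True
      obtain p where p: "\<And>y. \<psi> y \<le> \<psi> x + p \<bullet> (y - x) + Q (y - x)"
        using sg unfolding has_supergradients_def by blast
      \<comment> \<open>The ball of radius 1/2 about \<open>x - s / 2\<close> lies where
        \<open>p \<bullet> (y - x) \<le> 0\<close>, so there the function exceeds its value at
        \<open>x\<close> by at most \<open>C\<close>. For \<open>p = 0\<close> the ball is centred
        at \<open>x\<close>.\<close>
      define s where "s = sgn p"
      have s: "norm s \<le> 1" "p \<bullet> s = norm p"
        by (cases "p = 0"; simp add: s_def sgn_div_norm dot_square_norm power2_eq_square)+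
      have "- \<psi> x - C \<le> k"
      proof (rule k[OF True _ e])
        fix y assume y: "y \<in> ball (x - (1/2) *\<^sub>R s) (1/2)"
        define h where "h = y - x + (1/2) *\<^sub>R s"
        have h: "norm h \<le> 1/2" using y by (simp add: h_def dist_norm norm_minus_commute algebra_simps)
        have yx: "y - x = h - (1/2) *\<^sub>R s" by (simp add: h_def)
        have "p \<bullet> h \<le> norm p * norm h" by (rule norm_cauchy_schwarz)
        also have "\<dots> \<le> norm p * (1/2)" using h by (intro mult_left_mono) auto
        finally have "p \<bullet> (y - x) \<le> 0" unfolding yx by (simp add: inner_diff_right s)
        moreover have "norm (y - x) \<le> 1"
          unfolding yx using norm_triangle_ineq4[of h "(1/2) *\<^sub>R s"] h s by simp
        ultimately show "- \<psi> x - C \<le> \<bar>\<psi> y\<bar>" using p[of y] Q1[of "y - x"] by linarith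
      qed
      then show ?thesis by simp
    next
      case False
      then show ?thesis using k0 by simp
    qed
    have upper: "\<psi> x \<le> 3 * C + 3 * k"
    proof (cases "(\<psi> x - (C + k)) / 2 - C \<ge> 0")
      case True
      have "(\<psi> x - (C + k)) / 2 - C \<le> k"
      proof (rule k[OF True _ e])
        fix y assume y: "y \<in> ball x (1/2)"
        obtain p where p: "\<And>z. \<psi> z \<le> \<psi> y + p \<bullet> (z - y) + Q (z - y)"
          using sg unfolding has_supergradients_def by blast
        \<comment> \<open>\<open>z\<close> is the reflection of \<open>x\<close> in
          \<open>y\<close>: adding the supergradient inequalities at \<open>x\<close> and
          \<open>z\<close> cancels \<open>p\<close>, and \<open>lower\<close> bounds the value at
          \<open>z\<close>.\<close>
        define z where "z = 2 *\<^sub>R y - x"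
        have z: "z - y = - (x - y)" by (simp add: z_def scaleR_2)
        have "norm (x - y) \<le> 1" using y by (simp add: dist_norm)
        then have "Q (x - y) \<le> C" "Q (z - y) \<le> C" unfolding z by (auto intro: Q1 simp: norm_minus_commute)
        moreover have "p \<bullet> (z - y) = - (p \<bullet> (x - y))" unfolding z by (rule inner_minus_right)
        ultimately show "(\<psi> x - (C + k)) / 2 - C \<le> \<bar>\<psi> y\<bar>"
          using p[of x] p[of z] lower[of z] by (simp add: field_simps)
      qed
      then show ?thesis by (simp add: field_simps)
    next
      case False
      then show ?thesis using k0 C by (simp add: field_simps)
    qed
    show "\<bar>\<psi> x\<bar> \<le> 3 * C + 3 * k" using upper lower[of x] C k0 by linarith
  qed
qed

section \<open>Existence and uniqueness of the projection\<close>

theorem unique_L2_projection: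
  fixes u Q :: "'a::euclidean_space \<Rightarrow> real"
  defines "X \<equiv> {\<psi>. (\<exists>L. L-lipschitz_on UNIV \<psi>) \<and> has_supergradients Q \<psi>}"
    and "J \<equiv> \<lambda>\<psi>. sq_int (\<lambda>x. \<psi> x - u x)"
  assumes u: "Lu-lipschitz_on UNIV u" and u_fin: "sq_int u < \<infinity>"
    and Q: "\<And>h. Q h \<le> C * (norm h)\<^sup>2" and Q0: "\<And>h. 0 \<le> Q h"
  obtains \<phi> where "\<phi> \<in> X" "sq_int \<phi> < \<infinity>" "\<And>\<psi>. \<psi> \<in> X \<Longrightarrow> J \<phi> \<le> J \<psi>"
    "\<And>\<psi>. \<psi> \<in> X \<Longrightarrow> J \<psi> \<le> J \<phi> \<Longrightarrow> \<psi> = \<phi>"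
proof -
  define C' where "C' = \<bar>C\<bar>"
  have C': "C' \<ge> 0" by (simp add: C'_def)
  have Q: "Q h \<le> C' * (norm h)\<^sup>2" for h
  proof -
    have "C * (norm h)\<^sup>2 \<le> C' * (norm h)\<^sup>2" unfolding C'_def by (intro mult_right_mono) auto
    then show ?thesis using Q[of h] by linarith
  qed
  have [measurable]: "u \<in> borel_measurable borel" using u by (rule lipschitz_imp_borel_measurable)
  have XB [measurable_dest]: "\<psi> \<in> borel_measurable borel" if "\<psi> \<in> X" for \<psi>
    using that lipschitz_imp_borel_measurable unfolding X_def by blast
  \<comment> \<open>As \<open>Q\<close> is nonnegative, the zero function is a competitor, and it
    makes the infimum finite.\<close>
  have zero: "(\<lambda>x. 0) \<in> X"
    unfolding X_def has_supergradients_def using Q0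
    by (auto intro!: exI[of _ 0] lipschitz_onI exI[of _ "0::'a"])
  have J0: "J (\<lambda>x. 0) = sq_int u" by (simp add: J_def sq_int_def)
  define m where "m = (INF \<psi>\<in>X. J \<psi>)"
  have m_le: "m \<le> J \<psi>" if "\<psi> \<in> X" for \<psi> using that unfolding m_def by (rule INF_lower)
  have "m < \<infinity>" using m_le[OF zero] u_fin unfolding J0 by (rule le_less_trans)
  then obtain r where r: "m = ennreal r" "r \<ge> 0" by (cases m) auto
  obtain e0 where e0: "sq_int u = ennreal e0" "e0 \<ge> 0" using u_fin by (cases "sq_int u") auto
  have mid: "(\<lambda>x. (f x + g x) / 2) \<in> X" if fg: "f \<in> X" "g \<in> X" for f g
  proof -
    obtain L where "L-lipschitz_on UNIV f" using fg X_def by blast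
    moreover obtain M where "M-lipschitz_on UNIV g" using fg X_def by blast
    ultimately have "(\<bar>1/2\<bar> * (L + M))-lipschitz_on UNIV (\<lambda>x. (1/2) *\<^sub>R (f x + g x))"
      by (intro lipschitz_on_cmult lipschitz_on_add)
    then show ?thesis using fg has_supergradients_average[of Q f g] unfolding X_def by auto
  qed
  \<comment> \<open>Parallelogram identity for \<open>f - u\<close> and \<open>g - u\<close>: the
    midpoint of \<open>f\<close> and \<open>g\<close> is again admissible and accounts for at least
    \<open>4 * r\<close>, so only the excesses \<open>a\<close> and \<open>b\<close> remain.\<close>
  have close: "sq_int (\<lambda>x. f x - g x) \<le> ennreal (2 * a + 2 * b)"
    if fg: "f \<in> X" "g \<in> X" and a: "J f \<le> ennreal (r + a)" "a \<ge> 0" and b: "J g \<le> ennreal (r + b)" "b \<ge> 0"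
    for f g a b
  proof -
    note [measurable] = XB[OF fg(1)] XB[OF fg(2)]
    define h where "h x = (f x + g x) / 2 - u x" for x
    have [measurable]: "h \<in> borel_measurable borel" unfolding h_def by measurable
    have "(\<lambda>x. (f x - u x) + (g x - u x)) = (\<lambda>x. 2 * h x)" "(\<lambda>x. (f x - u x) - (g x - u x)) = (\<lambda>x. f x - g x)"
      by (auto simp: h_def)
    then have "4 * sq_int h + sq_int (\<lambda>x. f x - g x) = 2 * J f + 2 * J g"
      using sq_int_parallelogram[of "\<lambda>x. f x - u x" "\<lambda>x. g x - u x"] sq_int_cmult[of h 2]
      by (simp add: J_def)
    also have "\<dots> \<le> 2 * ennreal (r + a) + 2 * ennreal (r + b)" using a b by (intro add_mono mult_left_mono) auto
    also have "\<dots> = ennreal (4 * r + (2 * a + 2 * b))"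
    proof -
      have "2 * ennreal (r + a) + 2 * ennreal (r + b) = ennreal (2 * (r + a)) + ennreal (2 * (r + b))"
        using a b r by (simp add: ennreal_mult)
      also have "\<dots> = ennreal (2 * (r + a) + 2 * (r + b))" using a b r by (simp add: ennreal_plus[symmetric] del: ennreal_plus)
      finally show ?thesis by (simp add: algebra_simps)
    qed
    finally have ub: "4 * sq_int h + sq_int (\<lambda>x. f x - g x) \<le> ennreal (4 * r + (2 * a + 2 * b))" .
    have "ennreal (4 * r) \<le> 4 * sq_int h"
      using m_le[OF mid[OF fg]] r mult_left_mono[of "ennreal r" "sq_int h" 4]
      by (simp add: J_def h_def[abs_def] ennreal_mult)
    then have le: "ennreal (4 * r) + sq_int (\<lambda>x. f x - g x) \<le> ennreal (4 * r + (2 * a + 2 * b))"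
      using ub by (meson add_right_mono order_trans)
    show ?thesis
    proof (cases "sq_int (\<lambda>x. f x - g x)")
      case (real s)
      have "ennreal (4 * r + s) \<le> ennreal (4 * r + (2 * a + 2 * b))"
        using le r real by (simp add: ennreal_plus[symmetric] del: ennreal_plus)
      then have "4 * r + s \<le> 4 * r + (2 * a + 2 * b)"
        by (rule iffD1[OF ennreal_le_iff, rotated]) (use r a b in simp)
      then have "s \<le> 2 * a + 2 * b" by simp
      then show ?thesis unfolding real(2) by (rule ennreal_leI)
    next
      case top
      then show ?thesis using le by (simp add: top_unique)
    qed
  qed
  have "\<exists>\<psi>\<in>X. J \<psi> < ennreal (r + 1 / real (Suc n))" for n
  proof -
    have "m < ennreal (r + 1 / real (Suc n))" using r by (simp add: ennreal_lessI)
    then show ?thesis unfolding m_def INF_less_iff .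
  qed
  then obtain f where f: "\<And>n. f n \<in> X" "\<And>n. J (f n) < ennreal (r + 1 / real (Suc n))" by metis
  \<comment> \<open>Writing \<open>f n\<close> as \<open>(f n - u) + u\<close>, the parallelogram
    identity replaces the triangle inequality and bounds the norms uniformly in \<open>n\<close>,
    which yields the common constants \<open>K\<close> and \<open>L\<close>.\<close>
  have f_sq: "sq_int (f n) \<le> ennreal (2 * (r + 1) + 2 * e0)" for n
  proof -
    note [measurable] = XB[OF f(1)[of n]]
    have "sq_int (f n) \<le> sq_int (\<lambda>x. (f n x - u x) + u x) + sq_int (\<lambda>x. (f n x - u x) - u x)" by simp
    also have "\<dots> = 2 * J (f n) + 2 * sq_int u" by (subst sq_int_parallelogram) (auto simp: J_def)
    also have "\<dots> \<le> 2 * ennreal (r + 1) + 2 * ennreal e0"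
    proof -
      have "J (f n) \<le> ennreal (r + 1 / real (Suc n))" using f(2)[of n] by simp
      also have "\<dots> \<le> ennreal (r + 1)" by (intro ennreal_leI) (simp add: field_simps)
      finally show ?thesis using e0 by (intro add_mono mult_left_mono) auto
    qed
    also have "\<dots> = ennreal (2 * (r + 1) + 2 * e0)" using r e0 by (simp add: ennreal_mult)
    finally show ?thesis .
  qed
  have f_sg: "has_supergradients Q (f n)" for n using f(1)[of n] by (simp add: X_def)
  obtain K where K0: "\<And>(\<psi>::'a \<Rightarrow> real) x. has_supergradients Q \<psi> \<Longrightarrow>
      sq_int \<psi> \<le> ennreal (2 * (r + 1) + 2 * e0) \<Longrightarrow> \<bar>\<psi> x\<bar> \<le> K"
    by (rule has_supergradients_sq_int_bounded[OF Q C', where e = "2 * (r + 1) + 2 * e0"])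
      (rule that, blast)
  have K: "\<bar>f n x\<bar> \<le> K" for n x by (rule K0[OF f_sg f_sq])
  define L where "L = 2 * K + 2 * C'"
  have L: "L-lipschitz_on UNIV (f n)" for n
    unfolding L_def by (rule has_supergradients_lipschitz[OF f_sg Q C' K])
  \<comment> \<open>By \<open>close\<close> the sequence is Cauchy in L2; since all differences
    share the Lipschitz constant \<open>L + L\<close>, this passes to each point.\<close>
  have "Cauchy (\<lambda>n. f n x)" for x
  proof (rule metric_CauchyI)
    fix \<epsilon> :: real assume "\<epsilon> > 0"
    then obtain \<eta> where \<eta>: "\<eta> > 0"
      "\<And>(g::'a \<Rightarrow> real) x. (L + L)-lipschitz_on UNIV g \<Longrightarrow> sq_int g < ennreal \<eta> \<Longrightarrow> \<bar>g x\<bar> < \<epsilon>"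
      using lipschitz_small_sq_int[of \<epsilon> "L + L", where ?'a='a] by blast
    obtain N where N: "inverse (real (Suc N)) < \<eta> / 4" using reals_Archimedean[of "\<eta> / 4"] \<eta> by auto
    show "\<exists>M. \<forall>i\<ge>M. \<forall>j\<ge>M. dist (f i x) (f j x) < \<epsilon>"
    proof (intro exI[of _ N] allI impI)
      fix i j assume ij: "N \<le> i" "N \<le> j"
      have le: "1 / real (Suc i) \<le> 1 / real (Suc N)" "1 / real (Suc j) \<le> 1 / real (Suc N)"
        using ij by (auto intro!: divide_left_mono)
      have "sq_int (\<lambda>x. f i x - f j x) \<le> ennreal (2 * (1 / real (Suc i)) + 2 * (1 / real (Suc j)))"
        by (intro close f less_imp_le[OF f(2)]) auto
      also have "\<dots> < ennreal \<eta>" using le N \<eta>(1) by (intro ennreal_lessI) (auto simp: inverse_eq_divide)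
      finally have "\<bar>f i x - f j x\<bar> < \<epsilon>"
        by (intro \<eta>(2)[of "\<lambda>x. f i x - f j x"] lipschitz_on_diff L)
      then show "dist (f i x) (f j x) < \<epsilon>" by (simp add: dist_real_def)
    qed
  qed
  then have "\<forall>x. \<exists>l. (\<lambda>n. f n x) \<longlonglongrightarrow> l" using Cauchy_convergent convergent_def by blast
  then obtain \<phi> where \<phi>: "\<And>x. (\<lambda>n. f n x) \<longlonglongrightarrow> \<phi> x" by metis
  have "L-lipschitz_on UNIV \<phi>"
  proof (rule lipschitz_onI)
    fix x y
    have "(\<lambda>n. dist (f n x) (f n y)) \<longlonglongrightarrow> dist (\<phi> x) (\<phi> y)" by (intro tendsto_intros \<phi>)
    then show "dist (\<phi> x) (\<phi> y) \<le> L * dist x y"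
      by (rule LIMSEQ_le_const2) (use lipschitz_onD[OF L] in auto)
  qed (use lipschitz_on_nonneg[OF L] in simp)
  moreover have "has_supergradients Q \<phi>" by (rule has_supergradients_limit[OF f_sg Q C' K \<phi>])
  ultimately have \<phi>X: "\<phi> \<in> X" unfolding X_def by blast
  note [measurable] = XB[OF \<phi>X] XB[OF f(1)]
  \<comment> \<open>Taken with \<open>v = u\<close> this gives minimality of the limit, with
    \<open>v = 0\<close> its square integrability.\<close>
  have fatou: "sq_int (\<lambda>x. \<phi> x - v x) \<le> liminf (\<lambda>n. sq_int (\<lambda>x. f n x - v x))"
    if [measurable]: "v \<in> borel_measurable borel" for v
  proof -
    have "liminf (\<lambda>n. ennreal ((f n x - v x)\<^sup>2)) = ennreal ((\<phi> x - v x)\<^sup>2)" for x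
      by (intro lim_imp_Liminf tendsto_intros \<phi>) auto
    then show ?thesis
      using nn_integral_liminf[of "\<lambda>n x. ennreal ((f n x - v x)\<^sup>2)" lborel] by (simp add: sq_int_def)
  qed
  have J\<phi>: "J \<phi> \<le> m"
  proof -
    have "J \<phi> \<le> liminf (\<lambda>n. J (f n))" unfolding J_def by (rule fatou) simp
    also have "\<dots> \<le> liminf (\<lambda>n. ennreal (r + 1 / real (Suc n)))"
      by (intro Liminf_mono always_eventually allI less_imp_le[OF f(2)])
    also have "\<dots> = ennreal (r + 0)"
      by (intro lim_imp_Liminf tendsto_ennrealI tendsto_add tendsto_const) 
        (use LIMSEQ_inverse_real_of_nat in \<open>auto simp: inverse_eq_divide\<close>)
    finally show ?thesis using r by simp
  qed
  show ?thesis
  proof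
    show "\<phi> \<in> X" by (rule \<phi>X)
    have "sq_int \<phi> \<le> liminf (\<lambda>n. sq_int (f n))" using fatou[of "\<lambda>x. 0"] by simp
    also have "\<dots> \<le> liminf (\<lambda>n::nat. ennreal (2 * (r + 1) + 2 * e0))"
      using f_sq by (intro Liminf_mono) auto
    also have "\<dots> < \<infinity>" by (simp add: Liminf_const)
    finally show "sq_int \<phi> < \<infinity>" .
    show "J \<phi> \<le> J \<psi>" if "\<psi> \<in> X" for \<psi> using J\<phi> m_le[OF that] by (rule order_trans)
    show "\<psi> = \<phi>" if \<psi>: "\<psi> \<in> X" "J \<psi> \<le> J \<phi>" for \<psi>
    proof
      fix x
      obtain M where M: "M-lipschitz_on UNIV \<psi>" using \<psi>(1) X_def by blast
      obtain N where N: "N-lipschitz_on UNIV \<phi>" using \<phi>X X_def by blast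
      \<comment> \<open>Two minimizers have no excess over \<open>r\<close>, so their difference has
        norm zero and, being Lipschitz, vanishes everywhere.\<close>
      have "sq_int (\<lambda>x. \<psi> x - \<phi> x) \<le> ennreal (2 * 0 + 2 * 0)"
        using \<psi> J\<phi> r by (intro close \<phi>X) (auto intro: order_trans)
      then have "\<psi> x - \<phi> x = 0"
        by (intro lipschitz_sq_int_zero[of "M + N" "\<lambda>x. \<psi> x - \<phi> x"] lipschitz_on_diff M N) simp
      then show "\<psi> x = \<phi> x" by simp
    qed
  qed
qed

subsection \<open>Reachable set of a quadratic Hamiltonian\<close>

text \<open>Comparison in both directions gives equality before time \<open>T\<close>; the terminal
  time follows by continuity along times increasing to \<open>T\<close>.\<close>

theorem viscosity_solution_unique:
  fixes H :: "real ^ 'n \<Rightarrow> real"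
  assumes H: "continuous_on UNIV H"
    and u: "viscosity_solution H T u0 u" and v: "viscosity_solution H T u0 v"
    and t: "0 \<le> t" "t \<le> T"
  shows "u (t, x) = v (t, x)"
proof -
  have below: "u (s, x) = v (s, x)" if "0 \<le> s" "s < T" for s
    using viscosity_comparison[OF H, of T u v s x] viscosity_comparison[OF H, of T v u s x] u v that
    unfolding viscosity_solution_def by (simp add: antisym)
  show ?thesis
  proof (cases "t < T \<or> T = 0")
    case True
    then show ?thesis using below t u v unfolding viscosity_solution_def by fastforce
  next
    case False
    then have T: "t = T" "T > 0" using t by auto
    define s where "s n = T * (1 - inverse (real (Suc n)))" for n
    have s_lim: "s \<longlonglongrightarrow> T"
      unfolding s_def by (rule tendsto_eq_intros LIMSEQ_inverse_real_of_nat refl | simp)+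
    have s: "0 \<le> s n" "s n < T" for n using T(2) by (auto simp: s_def field_simps)
    have lim: "(\<lambda>n. w (s n, x)) \<longlonglongrightarrow> w (T, x)" if "viscosity_solution H T u0 w" for w
    proof -
      have "continuous_on ({0..T} \<times> UNIV) w"
        using that by (auto simp: viscosity_solution_def intro: uniformly_continuous_imp_continuous)
      then show ?thesis
        by (rule continuous_on_tendsto_compose)
          (use s T(2) in \<open>auto intro!: tendsto_intros s_lim simp: less_imp_le\<close>)
    qed
    have "(\<lambda>n. u (s n, x)) \<longlonglongrightarrow> v (T, x)" using lim[OF v] below s by simp
    then show ?thesis using lim[OF u] T(1) LIMSEQ_unique by blast
  qed
qed

text \<open>The forms of \<open>S\<close> and of its inverse \<open>B\<close>, each halved, are
  Legendre conjugates. The factor 2 in the coercivity of \<open>B\<close> makes \<open>c\<close> the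
  constant for \<open>L\<close>.\<close>

locale dual_quadratic_forms =
  fixes S B :: "real ^ 'n \<Rightarrow> real ^ 'n" and c :: real
  assumes S_linear: "linear S" and B_linear: "linear B"
    and S_B: "\<And>x. S (B x) = x" and B_S: "\<And>x. B (S x) = x"
    and S_sym: "\<And>x y. S x \<bullet> y = x \<bullet> S y"
    and c_pos: "c > 0" and B_coercive: "\<And>x. 2 * c * (norm x)\<^sup>2 \<le> B x \<bullet> x"
begin

definition H :: "real ^ 'n \<Rightarrow> real" where "H p = (S p \<bullet> p) / 2"

definition L :: "real ^ 'n \<Rightarrow> real" where "L q = (B q \<bullet> q) / 2"

lemma B_sym: "B x \<bullet> y = x \<bullet> B y"
  by (metis S_B S_sym)

lemma L_nonneg: "0 \<le> L q"
  using B_coercive[of q] c_pos order_trans[of 0 "2 * c * (norm q)\<^sup>2"] by (simp add: L_def)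

lemma L_coercive: "c * (norm q)\<^sup>2 \<le> L q"
  using B_coercive[of q] by (simp add: L_def)

lemma L_add: "L (x + y) = L x + B x \<bullet> y + L y"
  by (simp add: L_def linear_add[OF B_linear] inner_add_left inner_add_right B_sym[of y x]
      inner_commute[of y "B x"] field_simps)

lemma L_scale: "L (a *\<^sub>R x) = a\<^sup>2 * L x"
  by (simp add: L_def linear_scale[OF B_linear] power2_eq_square)

lemma L_convex: "convex_on UNIV L"
proof (rule convex_onI)
  fix t :: real and x y :: "real ^ 'n" assume t: "0 < t" "t < 1"
  have "L y = L (x + (y - x))" by simp
  also have "\<dots> = L x + B x \<bullet> (y - x) + L (y - x)" by (rule L_add)
  finally have y: "L y = L x + B x \<bullet> (y - x) + L (y - x)" .
  have "(1 - t) *\<^sub>R x + t *\<^sub>R y = x + t *\<^sub>R (y - x)" by (simp add: algebra_simps)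
  then have "L ((1 - t) *\<^sub>R x + t *\<^sub>R y) = L x + t * (B x \<bullet> (y - x)) + t\<^sup>2 * L (y - x)"
    by (simp only: L_add L_scale inner_scaleR_right)
  moreover have "t\<^sup>2 * L (y - x) \<le> t * L (y - x)"
    using t L_nonneg by (intro mult_right_mono) (auto simp: power2_eq_square)
  ultimately show "L ((1 - t) *\<^sub>R x + t *\<^sub>R y) \<le> (1 - t) * L x + t * L y"
    unfolding y by (simp add: algebra_simps)
qed simp

lemma L_continuous: "continuous_on UNIV L"
  unfolding L_def using linear_continuous_on[of B UNIV] B_linear
  by (intro continuous_intros) (auto simp: linear_conv_bounded_linear)

lemma H_continuous: "continuous_on UNIV H"
  unfolding H_def using linear_continuous_on[of S UNIV] S_linear
  by (intro continuous_intros) (auto simp: linear_conv_bounded_linear)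

lemma L_quadratic_bound: obtains C where "\<And>h. L h \<le> C * (norm h)\<^sup>2"
proof -
  obtain b where b: "\<And>x. norm (B x) \<le> b * norm x"
    using linear_bounded[OF B_linear] by blast
  have "L h \<le> b / 2 * (norm h)\<^sup>2" for h
  proof -
    have "B h \<bullet> h \<le> norm (B h) * norm h" by (rule norm_cauchy_schwarz)
    also have "\<dots> \<le> b * norm h * norm h" by (intro mult_right_mono b) auto
    finally show ?thesis by (simp add: L_def power2_eq_square)
  qed
  then show ?thesis by (rule that)
qed

lemma legendre: "\<exists>q. q \<bullet> p = H p + L q"
  by (rule exI[of _ "S p"]) (simp add: H_def L_def B_S inner_commute)

text \<open>This is the nonnegativity of \<open>L (q - S p)\<close>, expanded with
  \<open>B (S p) = p\<close>; equality occurs at \<open>q = S p\<close>.\<close>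

lemma young: "q \<bullet> p \<le> H p + L q"
proof -
  have "0 \<le> L (q - S p)" by (rule L_nonneg)
  also have "\<dots> = L (- S p) + B (- S p) \<bullet> q + L q" using L_add[of "- S p" q] by simp
  also have "L (- S p) = H p" using L_scale[of "-1" "S p"] by (simp add: H_def L_def B_S inner_commute)
  also have "B (- S p) = - p" using linear_neg[OF B_linear, of "S p"] by (simp add: B_S)
  finally show ?thesis by (simp add: inner_commute)
qed

lemma hopf_lax_data: "K-lipschitz_on UNIV u0 \<Longrightarrow> hopf_lax_data L c K u0"
  using L_convex L_continuous L_coercive c_pos L_scale[of 0 0] by unfold_locales auto

lemma hopf_lax_viscosity:
  assumes "K-lipschitz_on UNIV u0"
  shows "viscosity_solution H T u0 (hopf_lax L u0)"
  by (rule hopf_lax_viscosity_solution[OF hopf_lax_data[OF assms] young legendre])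

text \<open>The optimal foot point for \<open>x\<close> is kept for every \<open>y\<close>, which
  changes the velocity to \<open>q + (y - x) / T\<close>. Expanding the quadratic cost exhibits
  \<open>B q\<close> as supergradient and \<open>L (y - x) / T\<close> as error.\<close>

lemma hopf_lax_has_supergradients:
  assumes T: "T > 0" and "K-lipschitz_on UNIV u0"
  shows "has_supergradients (\<lambda>h. L h / T) (\<lambda>x. hopf_lax L u0 (T, x))"
  unfolding has_supergradients_def
proof
  interpret D: hopf_lax_data L c K u0 using assms(2) by (rule hopf_lax_data)
  fix x
  obtain q where q: "hopf_lax L u0 (T, x) = u0 (x - T *\<^sub>R q) + T * L q"
    using D.hopf_lax_attained[of T x] T by auto
  have "hopf_lax L u0 (T, y) \<le> hopf_lax L u0 (T, x) + B q \<bullet> (y - x) + L (y - x) / T" for y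
  proof -
    have "y - T *\<^sub>R (q + (1 / T) *\<^sub>R (y - x)) = x - T *\<^sub>R q"
      using T by (simp add: algebra_simps)
    then have "hopf_lax L u0 (T, y) \<le> u0 (x - T *\<^sub>R q) + T * L (q + (1 / T) *\<^sub>R (y - x))"
      using D.hopf_lax_le[of T y "q + (1 / T) *\<^sub>R (y - x)"] T by simp
    also have "\<dots> = hopf_lax L u0 (T, x) + B q \<bullet> (y - x) + L (y - x) / T"
      unfolding q L_add L_scale inner_scaleR_right using T by (simp add: field_simps power2_eq_square)
    finally show ?thesis .
  qed
  then show "\<exists>p. \<forall>y. hopf_lax L u0 (T, y) \<le> hopf_lax L u0 (T, x) + p \<bullet> (y - x) + L (y - x) / T"
    by blast
qed

text \<open>The initial datum is the backward Hopf--Lax evolution of \<open>\<psi>\<close>; evolving it forward again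
  recovers \<open>\<psi>\<close> exactly when \<open>\<psi>\<close> has the supergradients below.\<close>

lemma hopf_lax_surjective:
  fixes \<psi> :: "real ^ 'n \<Rightarrow> real"
  assumes T: "T > 0" and \<psi>: "K-lipschitz_on UNIV \<psi>"
    and sg: "has_supergradients (\<lambda>h. L h / T) \<psi>"
  obtains u0 where "K-lipschitz_on UNIV u0" "\<And>x. hopf_lax L u0 (T, x) = \<psi> x"
proof -
  define u0 where "u0 x = (SUP h. \<psi> (x + h) - L h / T)" for x
  have \<psi>_le: "\<psi> x \<le> \<psi> y + K * norm (x - y)" for x y
    using lipschitz_onD[OF \<psi>, of x y] by (simp add: dist_real_def dist_norm abs_le_iff)
  have bdd: "bdd_above (range (\<lambda>h. \<psi> (x + h) - L h / T))" for x
  proof (rule bdd_aboveI2)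
    fix h :: "real ^ 'n"
    define a where "a = c / T"
    have a: "a > 0" using T c_pos by (simp add: a_def)
    \<comment> \<open>Completing the square: the quadratic decay of \<open>- L h / T\<close> beats
      the linear growth of \<open>\<psi>\<close>, so the supremum defining \<open>u0\<close> is
      finite.\<close>
    have "K * norm h \<le> a * (norm h)\<^sup>2 + K\<^sup>2 / (4 * a)"
    proof -
      have "0 \<le> (2 * a * norm h - K)\<^sup>2 / (4 * a)" using a by simp
      also have "\<dots> = a * (norm h)\<^sup>2 + K\<^sup>2 / (4 * a) - K * norm h"
        using a by (simp add: power2_diff power_mult_distrib diff_divide_distrib add_divide_distrib)
          (simp add: power2_eq_square)
      finally show ?thesis by simp
    qed
    moreover have "a * (norm h)\<^sup>2 \<le> L h / T"
      using divide_right_mono[OF L_coercive[of h], of T] T by (simp add: a_def)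
    ultimately show "\<psi> (x + h) - L h / T \<le> \<psi> x + K\<^sup>2 / (4 * (c / T))"
      using \<psi>_le[of "x + h" x] by (simp add: a_def)
  qed
  have ge: "\<psi> (x + h) - L h / T \<le> u0 x" for x h
    unfolding u0_def by (rule cSUP_upper[OF _ bdd]) simp
  have le: "u0 x \<le> b" if "\<And>h. \<psi> (x + h) - L h / T \<le> b" for x b
    unfolding u0_def by (rule cSUP_least) (use that in auto)
  have u0_le: "u0 x \<le> u0 y + K * norm (x - y)" for x y
  proof (rule le)
    fix h
    show "\<psi> (x + h) - L h / T \<le> u0 y + K * norm (x - y)"
      using ge[of y h] \<psi>_le[of "x + h" "y + h"] by simp
  qed
  have lip: "K-lipschitz_on UNIV u0"
  proof (rule lipschitz_onI)
    fix x y
    show "dist (u0 x) (u0 y) \<le> K * dist x y"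
      using u0_le[of x y] u0_le[of y x] by (simp add: dist_real_def dist_norm norm_minus_commute abs_le_iff)
  qed (rule lipschitz_on_nonneg[OF \<psi>])
  interpret D: hopf_lax_data L c K u0 using lip by (rule hopf_lax_data)
  have L_T: "L (T *\<^sub>R q) / T = T * L q" for q using T by (simp add: L_scale power2_eq_square)
  have "hopf_lax L u0 (T, x) = \<psi> x" for x
  proof (rule antisym)
    obtain q where q: "hopf_lax L u0 (T, x) = u0 (x - T *\<^sub>R q) + T * L q"
      using D.hopf_lax_attained[of T x] T by auto
    show "\<psi> x \<le> hopf_lax L u0 (T, x)"
      using ge[of "x - T *\<^sub>R q" "T *\<^sub>R q"] unfolding q L_T by simp
    obtain p where p: "\<And>y. \<psi> y \<le> \<psi> x + p \<bullet> (y - x) + L (y - x) / T"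
      using sg unfolding has_supergradients_def by blast
    \<comment> \<open>This velocity satisfies \<open>B r = p\<close>, so expanding
      \<open>L h / T\<close> around \<open>T *\<^sub>R r\<close> reproduces the linear and quadratic
      terms of the supergradient inequality, and they cancel.\<close>
    define r where "r = S p"
    have "u0 (x - T *\<^sub>R r) \<le> \<psi> x - T * L r"
    proof (rule le)
      fix h
      define d where "d = h - T *\<^sub>R r"
      have "L h = L (T *\<^sub>R r + d)" by (simp add: d_def)
      then have "L h / T = L (T *\<^sub>R r) / T + B (T *\<^sub>R r) \<bullet> d / T + L d / T"
        by (simp only: L_add add_divide_distrib)
      also have "\<dots> = T * L r + p \<bullet> d + L d / T"
        unfolding L_T using T by (simp add: linear_scale[OF B_linear] r_def B_S)
      finally show "\<psi> (x - T *\<^sub>R r + h) - L h / T \<le> \<psi> x - T * L r"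
        using p[of "x + d"] by (simp add: d_def algebra_simps)
    qed
    then show "hopf_lax L u0 (T, x) \<le> \<psi> x" using D.hopf_lax_le[of T x r] T by simp
  qed
  with lip show ?thesis by (rule that)
qed

text \<open>Uniqueness identifies any solution with the Hopf-Lax one, which has the supergradients;
  conversely \<open>hopf_lax_surjective\<close> supplies an initial datum.\<close>

theorem reachable_set_eq:
  assumes T: "T > 0"
  shows "reachable_set H T =
    {\<psi>. (\<exists>K. K-lipschitz_on UNIV \<psi>) \<and> has_supergradients (\<lambda>h. L h / T) \<psi>}"
proof (intro set_eqI iffI)
  fix \<psi> assume "\<psi> \<in> reachable_set H T"
  then obtain u0 K u where \<psi>: "\<exists>K. K-lipschitz_on UNIV \<psi>" and u0: "K-lipschitz_on UNIV u0"
    and u: "viscosity_solution H T u0 u" "\<And>x. u (T, x) = \<psi> x"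
    unfolding reachable_set_def Lip_def by auto
  have "\<psi> = (\<lambda>x. hopf_lax L u0 (T, x))"
  proof
    fix x
    show "\<psi> x = hopf_lax L u0 (T, x)"
      using viscosity_solution_unique[OF H_continuous u(1) hopf_lax_viscosity[OF u0], of T x] T u(2)
      by simp
  qed
  then show "\<psi> \<in> {\<psi>. (\<exists>K. K-lipschitz_on UNIV \<psi>) \<and> has_supergradients (\<lambda>h. L h / T) \<psi>}"
    using \<psi> hopf_lax_has_supergradients[OF T u0] by simp
next
  fix \<psi> assume "\<psi> \<in> {\<psi>. (\<exists>K. K-lipschitz_on UNIV \<psi>) \<and> has_supergradients (\<lambda>h. L h / T) \<psi>}"
  then obtain K where K: "K-lipschitz_on UNIV \<psi>" and sg: "has_supergradients (\<lambda>h. L h / T) \<psi>"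
    by blast
  obtain u0 where u0: "K-lipschitz_on UNIV u0" "\<And>x. hopf_lax L u0 (T, x) = \<psi> x"
    using hopf_lax_surjective[OF T K sg] by blast
  show "\<psi> \<in> reachable_set H T"
    unfolding reachable_set_def Lip_def using K u0 hopf_lax_viscosity[OF u0(1)] by blast
qed

end

section \<open>From the matrix to the quadratic forms, and the conclusion\<close>

lemma positive_definite_dual_quadratic_forms:
  fixes A :: "real ^ 'n ^ 'n"
  assumes A: "positive_definite_matrix A"
  obtains S B c where "dual_quadratic_forms S B c" "\<And>p. (A *v p) \<bullet> p = S p \<bullet> p"
proof -
  \<comment> \<open>The symmetric part of \<open>A\<close> has the same quadratic form; positivity
    makes it injective, hence invertible.\<close>
  define S where "S p = (1/2) *\<^sub>R (A *v p + transpose A *v p)" for p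
  have S_lin: "linear S"
    unfolding S_def by (intro linear_compose_scale_right linear_compose_add matrix_vector_mul_linear)
  have tr: "(transpose A *v x) \<bullet> y = x \<bullet> (A *v y)" for x y
    by (metis dot_lmul_matrix inner_commute vector_transpose_matrix transpose_transpose transpose_matrix_vector)
  have S_sym: "S x \<bullet> y = x \<bullet> S y" for x y
    using tr[of x y] tr[of y x] by (simp add: S_def inner_add_left inner_add_right inner_commute)
  have SA: "(A *v p) \<bullet> p = S p \<bullet> p" for p
  proof -
    have "S p \<bullet> p = (1/2) * ((A *v p) \<bullet> p + (transpose A *v p) \<bullet> p)"
      by (simp only: S_def inner_scaleR_left inner_add_left)
    then show ?thesis unfolding tr inner_commute[of p "A *v p"] by simp
  qed
  have S_pos: "S p \<bullet> p > 0" if "p \<noteq> 0" for p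
    using A that unfolding positive_definite_matrix_def SA by blast
  have "x = 0" if "S x = 0" for x using S_pos[of x] that by force
  then have "inj S" using linear_injective_0[OF S_lin] by blast
  then obtain B where B: "linear B" "\<And>x. B (S x) = x" "\<And>x. S (B x) = x"
    using linear_injective_isomorphism[OF S_lin] by blast
  have B_pos: "B x \<bullet> x > 0" if "x \<noteq> 0" for x
  proof -
    have "B x \<noteq> 0" using that B(3)[of x] linear_0[OF S_lin] by metis
    then show ?thesis using S_pos[of "B x"] by (simp add: B(3) inner_commute)
  qed
  have cont: "continuous_on (sphere 0 1) (\<lambda>x. B x \<bullet> x)"
    using linear_continuous_on[of B] B(1)
    by (intro continuous_intros) (auto simp: linear_conv_bounded_linear)
  have "sphere (0 :: real ^ 'n) 1 \<noteq> {}" by simp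
  then obtain z where z: "norm z = 1" "\<And>x. norm x = 1 \<Longrightarrow> B z \<bullet> z \<le> B x \<bullet> x"
    using continuous_attains_inf[OF compact_sphere _ cont] by auto
  \<comment> \<open>Half the minimum of the inverse form on the unit sphere, positive by
    compactness; homogeneity extends the bound to all vectors.\<close>
  define c where "c = (B z \<bullet> z) / 2"
  have "c > 0" using B_pos[of z] z(1) by (force simp: c_def)
  moreover have "2 * c * (norm x)\<^sup>2 \<le> B x \<bullet> x" for x
  proof (cases "x = 0")
    case False
    have x: "x = norm x *\<^sub>R sgn x" using False by (simp add: sgn_div_norm)
    have "2 * c \<le> B (sgn x) \<bullet> sgn x" using z(2)[of "sgn x"] False by (simp add: c_def norm_sgn)
    then have "2 * c * (norm x)\<^sup>2 \<le> (norm x)\<^sup>2 * (B (sgn x) \<bullet> sgn x)"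
      using mult_left_mono[of "2 * c" _ "(norm x)\<^sup>2"] by (simp add: mult.commute)
    also have "\<dots> = B (norm x *\<^sub>R sgn x) \<bullet> (norm x *\<^sub>R sgn x)"
      by (simp only: linear_scale[OF B(1)] inner_scaleR_left inner_scaleR_right power2_eq_square mult.assoc)
    finally show ?thesis unfolding x[symmetric] .
  qed simp
  ultimately have "dual_quadratic_forms S B c"
    unfolding dual_quadratic_forms_def using S_lin B S_sym by blast
  then show ?thesis using SA by (rule that)
qed

text \<open>\<open>is_arg_min\<close> involves only strict comparisons, so this allows the norm to
  be replaced by its square, infinite values included.\<close>

lemma L2_norm_less_iff:
  fixes f g :: "real ^ 'n \<Rightarrow> real"
  shows "L2_norm f < L2_norm g \<longleftrightarrow> sq_int f < sq_int g"
proof -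
  have "L2_norm f = (if sq_int f = \<infinity> then \<infinity> else ennreal (sqrt (enn2real (sq_int f))))" for f :: "real ^ 'n \<Rightarrow> real"
    by (simp add: L2_norm_def sq_int_def Let_def)
  then show ?thesis
    by (cases "sq_int f"; cases "sq_int g") (auto simp: ennreal_less_iff top.not_eq_extremum)
qed

lemma sq_int_finite_compact_support:
  fixes u :: "'a::euclidean_space \<Rightarrow> real"
  assumes u: "continuous_on UNIV u" and "compact (closure {x. u x \<noteq> 0})"
  shows "sq_int u < \<infinity>"
proof -
  let ?S = "closure {x. u x \<noteq> 0}"
  have "integrable lborel (\<lambda>x. indicator ?S x *\<^sub>R (u x)\<^sup>2)"
    by (intro borel_integrable_compact assms continuous_intros continuous_on_subset[OF u]) simp
  moreover have "indicator ?S x *\<^sub>R (u x)\<^sup>2 = (u x)\<^sup>2" for x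
    using closure_subset[of "{x. u x \<noteq> 0}"] by (auto simp: indicator_def)
  ultimately have "integrable lborel (\<lambda>x. (u x)\<^sup>2)" by (simp only:)
  then show ?thesis unfolding sq_int_def by (simp add: nn_integral_eq_integral)
qed

theorem theorem9:
  fixes T :: real
    and A :: "real ^ 'n ^ 'n"
    and H :: "real ^ 'n \<Rightarrow> real"
    and u\<^sub>T :: "real ^ 'n \<Rightarrow> real"
  assumes "T > 0"
    and "positive_definite_matrix A"
    and "\<And>p. H p = ((A *v p) \<bullet> p) / 2"
    and "u\<^sub>T \<in> Lip"
    and "compact (closure {x. u\<^sub>T x \<noteq> 0})"
  shows "\<exists>\<phi> \<in> Lip \<inter> L2.
    is_arg_min (\<lambda>\<phi>. L2_norm (\<lambda>x. \<phi> x - u\<^sub>T x)) (\<lambda>\<phi>. \<phi> \<in> reachable_set H T) \<phi> \<and>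
    (\<forall>\<psi>. is_arg_min (\<lambda>\<phi>. L2_norm (\<lambda>x. \<phi> x - u\<^sub>T x)) (\<lambda>\<phi>. \<phi> \<in> reachable_set H T) \<psi> \<longrightarrow> \<psi> = \<phi>)"
proof -
  obtain S B c where "dual_quadratic_forms S B c" and SA: "\<And>p. (A *v p) \<bullet> p = S p \<bullet> p"
    using positive_definite_dual_quadratic_forms[OF assms(2)] by blast
  then interpret D: dual_quadratic_forms S B c by simp
  have H: "H = D.H" using assms(3) SA by (simp add: D.H_def fun_eq_iff)
  obtain K where K: "K-lipschitz_on UNIV u\<^sub>T" using assms(4) by (auto simp: Lip_def)
  have fin: "sq_int u\<^sub>T < \<infinity>"
    using lipschitz_on_continuous_on[OF K] assms(5) by (rule sq_int_finite_compact_support)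
  obtain C where C: "\<And>h. D.L h \<le> C * (norm h)\<^sup>2" using D.L_quadratic_bound by blast
  have Q: "D.L h / T \<le> C / T * (norm h)\<^sup>2" "0 \<le> D.L h / T" for h
    using C[of h] D.L_nonneg[of h] assms(1) by (auto simp: divide_right_mono)
  let ?X = "{\<psi>. (\<exists>K. K-lipschitz_on UNIV \<psi>) \<and> has_supergradients (\<lambda>h. D.L h / T) \<psi>}"
  obtain \<phi> where \<phi>: "\<phi> \<in> ?X" "sq_int \<phi> < \<infinity>"
    and min: "\<And>\<psi>. \<psi> \<in> ?X \<Longrightarrow> sq_int (\<lambda>x. \<phi> x - u\<^sub>T x) \<le> sq_int (\<lambda>x. \<psi> x - u\<^sub>T x)"
    and unique: "\<And>\<psi>. \<psi> \<in> ?X \<Longrightarrow> sq_int (\<lambda>x. \<psi> x - u\<^sub>T x) \<le> sq_int (\<lambda>x. \<phi> x - u\<^sub>T x) \<Longrightarrow> \<psi> = \<phi>"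
    by (rule unique_L2_projection[OF K fin Q]) (rule that)
  note R = D.reachable_set_eq[OF assms(1)]
  obtain M where M: "M-lipschitz_on UNIV \<phi>" using \<phi>(1) by blast
  have \<phi>_meas: "\<phi> \<in> borel_measurable borel" by (rule lipschitz_imp_borel_measurable[OF M])
  have "integrable lborel (\<lambda>x. (\<phi> x)\<^sup>2)"
    using \<phi>_meas \<phi>(2) by (intro integrableI_bounded) (auto simp: sq_int_def)
  then have "\<phi> \<in> Lip \<inter> L2" using M \<phi>_meas by (auto simp: Lip_def L2_def)
  moreover have "is_arg_min (\<lambda>\<phi>. L2_norm (\<lambda>x. \<phi> x - u\<^sub>T x)) (\<lambda>\<phi>. \<phi> \<in> reachable_set H T) \<phi>"
    unfolding is_arg_min_def L2_norm_less_iff H R using \<phi>(1) min by (auto simp: not_less)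
  moreover have "\<psi> = \<phi>"
    if "is_arg_min (\<lambda>\<phi>. L2_norm (\<lambda>x. \<phi> x - u\<^sub>T x)) (\<lambda>\<phi>. \<phi> \<in> reachable_set H T) \<psi>" for \<psi>
    using that \<phi>(1) unfolding is_arg_min_def L2_norm_less_iff H R by (intro unique) (auto simp: not_less)
  ultimately show ?thesis by blast
qed

end
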